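(* Let $\mathcal S=(a_i)_{i\ge1}$ and $\mathcal R=(b_i)_{i\ge1}$ be infinite sequences of elementary foldings such that $a_i=b_i$ for all but finitely many $i$. Then the folding patterns $P_{\mathcal S}$ and $P_{\mathcal R}$ are mutually locally derivable (MLD).
   Context: Grid: let $\xi_1=(0,-2\sqrt3)$ and let $\xi_2,\xi_3$ be its counterclockwise rotations by $2\pi/3$ and $4\pi/3$. For $i\in\{1,2,3\}$, $n\in\mathbb Z$ put $\ell_{i,n}=\{x\in\mathbb R^2:(x,\xi_i)=3n+1\}$. The union $\mathcal L$ of all $\ell_{i,n}$ is a triangular grid whose smallest triangles (unit triangles) are regular of side $1$; unit edges are the sides of unit triangles. $O$ is the origin and $T_0$ is the positive (vertex above its horizontal side) unit triangle centered at $O$; $(-2)^kT_0$ is its image under the homothety with center $O$ and ratio $(-2)^k$. Folding patterns: an elementary folding folds a paper regular triangle of side $2a$ along its three midsegments onto its central triangle of side $a$; it is a folding up ($+$) if all three folds go through the upper half-space of $\mathbb R^3$ and a folding down ($-$) if all go through the lower half-space. When unfolded, fold lines of a folding up become valleys and those of a folding down become peaks. For a finite sequence $(a_1,\dots,a_k)$ take the paper triangle $(-2)^kT_0$, perform $a_k$ first (onto $(-2)^{k-1}T_0$), then $a_{k-1}$, …, finally $a_1$ (onto $T_0$), then unfold; valleys are colored red and peaks blue. For an infinite sequence $\mathcal S=(a_i)_{i\ge1}$, $P_{\mathcal S}$ is the red/blue coloring of all unit edges of $\mathcal L$ in which each edge gets its color from the pattern of $(a_1,\dots,a_k)$ for any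 $k$ with the edge interior to $(-2)^kT_0$ (both $P_{\mathcal S}$ and $P_{\mathcal R}$ use the same $T_0$). MLD: a pattern $B$ is locally derivable from a pattern $A$ if there is $r>0$ such that whenever the restrictions of $A$ to the $r$-balls around two points $x,y$ coincide up to the translation by $y-x$, the local structures of $B$ at $x$ and $y$ coincide up to the same translation; $A$ and $B$ are MLD if each is locally derivable from the other. *)

theory Defs
  imports "HOL-Analysis.Analysis"
begin

text \<open>The Euclidean plane is \<^typ>\<open>complex\<close> with its real inner product \<open>\<bullet>\<close>; the
  counterclockwise rotation by an angle \<open>t\<close> is multiplication by \<open>cis t\<close>.\<close>

subsection \<open>The triangular grid\<close>

definition xi :: "nat \<Rightarrow> complex" where
  "xi i = cis (2 * pi * (real i - 1) / 3) * Complex 0 (- 2 * sqrt 3)"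

definition grid_line :: "nat \<Rightarrow> int \<Rightarrow> complex set" where
  "grid_line i n = {x. x \<bullet> xi i = 3 * of_int n + 1}"

definition grid :: "complex set" where
  "grid = (\<Union>i\<in>{1, 2, 3}. \<Union>n. grid_line i n)"

definition unit_triangle :: "complex \<Rightarrow> complex \<Rightarrow> complex \<Rightarrow> bool" where
  "unit_triangle a b c \<longleftrightarrow>
     dist a b = 1 \<and> dist b c = 1 \<and> dist c a = 1 \<and>
     closed_segment a b \<subseteq> grid \<and> closed_segment b c \<subseteq> grid \<and> closed_segment c a \<subseteq> grid"

definition unit_edge :: "complex set \<Rightarrow> bool" where
  "unit_edge e \<longleftrightarrow> (\<exists>a b c. unit_triangle a b c \<and> e = closed_segment a b)"

text \<open>\<open>T0_vertex 1\<close> is the top vertex of \<open>T\<^sub>0\<close>, and \<open>T0_vertex 2\<close>, \<open>T0_vertex 3\<close> are the ends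
  of its horizontal side; \<open>paper k\<close> is \<open>(-2)\<^sup>k T\<^sub>0\<close>.\<close>

definition T0_vertex :: "nat \<Rightarrow> complex" where
  "T0_vertex i = cis (2 * pi * (real i - 1) / 3) * Complex 0 (sqrt 3 / 3)"

definition T0 :: "complex set" where
  "T0 = convex hull {T0_vertex 1, T0_vertex 2, T0_vertex 3}"

definition paper :: "nat \<Rightarrow> complex set" where
  "paper k = (\<lambda>x. (- 2) ^ k *\<^sub>R x) ` T0"

definition paper_vertex :: "nat \<Rightarrow> nat \<Rightarrow> complex" where
  "paper_vertex k i = (- 2) ^ k *\<^sub>R T0_vertex i"

subsection \<open>Elementary foldings\<close>

datatype folding = Up | Down

datatype colour = Red | Blue

definition line_reflection :: "complex \<Rightarrow> complex \<Rightarrow> complex \<Rightarrow> complex" where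
  "line_reflection p q x = p + (q - p) * cnj ((x - p) / (q - p))"

definition corner :: "complex \<Rightarrow> complex \<Rightarrow> complex \<Rightarrow> complex set" where
  "corner A B C = convex hull {A, midpoint A B, midpoint A C}"

definition corners :: "complex \<Rightarrow> complex \<Rightarrow> complex \<Rightarrow> complex set set" where
  "corners A B C = {corner A B C, corner B C A, corner C A B}"

definition midsegments :: "complex \<Rightarrow> complex \<Rightarrow> complex \<Rightarrow> complex set set" where
  "midsegments A B C =
     {closed_segment (midpoint A B) (midpoint A C),
      closed_segment (midpoint B C) (midpoint B A),
      closed_segment (midpoint C A) (midpoint C B)}"

text \<open>Where an elementary folding of the triangle \<open>ABC\<close>, up or down, takes its points.\<close>

definition fold_map :: "complex \<Rightarrow> complex \<Rightarrow> complex \<Rightarrow> complex \<Rightarrow> complex" where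
  "fold_map A B C x =
     (if x \<in> corner A B C then line_reflection (midpoint A B) (midpoint A C) x
      else if x \<in> corner B C A then line_reflection (midpoint B C) (midpoint B A) x
      else if x \<in> corner C A B then line_reflection (midpoint C A) (midpoint C B) x
      else x)"

definition paper_fold :: "nat \<Rightarrow> complex \<Rightarrow> complex" where
  "paper_fold k = fold_map (paper_vertex k 1) (paper_vertex k 2) (paper_vertex k 3)"

definition paper_corners :: "nat \<Rightarrow> complex set set" where
  "paper_corners k = corners (paper_vertex k 1) (paper_vertex k 2) (paper_vertex k 3)"

definition paper_midsegments :: "nat \<Rightarrow> complex set set" where
  "paper_midsegments k = midsegments (paper_vertex k 1) (paper_vertex k 2) (paper_vertex k 3)"

subsection \<open>Folding patterns\<close>

text \<open>The folded paper has several layers, and a layer that lies upside down (\<open>face_up\<close> false)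
  sees a folding up as a folding down: seen from the upper side of the unfolded paper, a fold
  line is a valley iff the layer faced up and was folded up, or faced down and was folded down.\<close>

definition crease_colour :: "folding \<Rightarrow> bool \<Rightarrow> colour" where
  "crease_colour a face_up = (if (a = Up) = face_up then Red else Blue)"

text \<open>\<open>edge_colour S k face_up e\<close> follows an edge whose current position is \<open>e\<close>, in a layer with
  facing \<open>face_up\<close> of paper folded to the shape \<open>(-2)\<^sup>k T\<^sub>0\<close>, through the remaining foldings
  \<open>S k, \<dots>, S 1\<close>, in this order, until it becomes part of a fold line. Corners are turned over.
  The result is \<open>None\<close> for edges that are never folded, such as those on the boundary.
  Sequences are indexed from 1; \<open>S 0\<close> is not used.\<close>

primrec edge_colour :: "(nat \<Rightarrow> folding) \<Rightarrow> nat \<Rightarrow> bool \<Rightarrow> complex set \<Rightarrow> colour option" where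
  "edge_colour S 0 face_up e = None"
| "edge_colour S (Suc k) face_up e =
     (if \<exists>m\<in>paper_midsegments (Suc k). e \<subseteq> m
      then Some (crease_colour (S (Suc k)) face_up)
      else edge_colour S k
             (if \<exists>t\<in>paper_corners (Suc k). e \<subseteq> t then \<not> face_up else face_up)
             (paper_fold (Suc k) ` e))"

text \<open>A pattern is a set of coloured edges.\<close>

type_synonym 'c pattern = "(complex set \<times> 'c) set"

definition finite_folding_pattern :: "(nat \<Rightarrow> folding) \<Rightarrow> nat \<Rightarrow> colour pattern" where
  "finite_folding_pattern S k =
     {(e, c). unit_edge e \<and> e \<subseteq> paper k \<and> edge_colour S k True e = Some c}"

definition folding_pattern :: "(nat \<Rightarrow> folding) \<Rightarrow> colour pattern" where
  "folding_pattern S =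
     {(e, c). \<exists>k. e \<subseteq> interior (paper k) \<and> (e, c) \<in> finite_folding_pattern S k}"

subsection \<open>Mutual local derivability\<close>

definition translate_pattern :: "complex \<Rightarrow> 'c pattern \<Rightarrow> 'c pattern" where
  "translate_pattern v A = (\<lambda>(e, c). ((+) v ` e, c)) ` A"

definition restrict_pattern :: "'c pattern \<Rightarrow> complex set \<Rightarrow> 'c pattern" where
  "restrict_pattern A U = {(e \<inter> U, c) | e c. (e, c) \<in> A \<and> e \<inter> U \<noteq> {}}"

definition local_structure :: "'c pattern \<Rightarrow> complex \<Rightarrow> 'c pattern" where
  "local_structure A x = {(e, c) \<in> A. x \<in> e}"

definition locally_derivable_from :: "'d pattern \<Rightarrow> 'c pattern \<Rightarrow> bool" where
  "locally_derivable_from B A \<longleftrightarrow>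
     (\<exists>r>0. \<forall>x y.
        translate_pattern (y - x) (restrict_pattern A (ball x r)) = restrict_pattern A (ball y r)
        \<longrightarrow> translate_pattern (y - x) (local_structure B x) = local_structure B y)"

definition MLD :: "'c pattern \<Rightarrow> 'd pattern \<Rightarrow> bool" where
  "MLD A B \<longleftrightarrow> locally_derivable_from B A \<and> locally_derivable_from A B"

end

theory Submission
  imports Defs
begin

text \<open>
  Write \<open>x\<^sub>i = (x, \<xi>\<^sub>i)\<close>; these three coordinates sum to \<open>0\<close>. The fold lines of folding \<open>n + 1\<close> are the
  lines \<open>x\<^sub>i = (-2)\<^sup>n w\<close> of the grid with \<open>w\<close> odd, and an edge on such a line is coloured by the
  \<open>n + 1\<close>-st folding, reversed if the triangle of the \<open>(-2)\<^bsup>n+1\<^esup>\<close>-scaled grid containing the edge is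
  turned against \<open>(-2)\<^bsup>n+1\<^esup> T\<^sub>0\<close>. Hence along the line the colours alternate in blocks of \<open>2\<^sup>n\<close> unit
  edges. A line of level \<open>n\<close> is therefore told apart from one of higher level by three edges at
  distances \<open>0, 2\<^sup>n, 2 \<cdot> 2\<^sup>n\<close>: on the former the colours alternate, on the latter two consecutive
  ones agree. If two sequences agree beyond \<open>N\<close>, the colour of an edge in one pattern is determined by
  its colour in the other and by its level as far as the level is below \<open>N\<close>, so it can be read off
  from a ball of radius about \<open>2 \<cdot> 2\<^sup>N\<close>.
\<close>

section \<open>Triangular coordinates and reflections\<close>

lemma cis_thirds:
  "cis (2 * pi / 3) = Complex (- 1 / 2) (sqrt 3 / 2)"
  "cis (4 * pi / 3) = Complex (- 1 / 2) (- sqrt 3 / 2)"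
proof -
  have c: "cos (2 * pi / 3) = - 1 / 2" "sin (2 * pi / 3) = sqrt 3 / 2"
    by (simp_all add: cos_120 sin_120)
  show 1: "cis (2 * pi / 3) = Complex (- 1 / 2) (sqrt 3 / 2)"
    using c by (simp add: complex_eq_iff)
  have "cis (4 * pi / 3) = cis (2 * pi / 3) * cis (2 * pi / 3)"
    by (simp add: cis_mult)
  then show "cis (4 * pi / 3) = Complex (- 1 / 2) (- sqrt 3 / 2)"
    unfolding 1 by (simp add: complex_eq_iff)
qed

definition coord :: "nat \<Rightarrow> complex \<Rightarrow> real" where
  "coord i x = x \<bullet> xi i"

lemma coord_explicit:
  "coord 1 x = - 2 * sqrt 3 * Im x"
  "coord 2 x = 3 * Re x + sqrt 3 * Im x"
  "coord 3 x = - 3 * Re x + sqrt 3 * Im x"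
  by (simp_all add: coord_def xi_def cis_thirds inner_complex_def)

lemma T0_vertex_explicit:
  "T0_vertex 1 = Complex 0 (sqrt 3 / 3)"
  "T0_vertex 2 = Complex (- 1 / 2) (- sqrt 3 / 6)"
  "T0_vertex 3 = Complex (1 / 2) (- sqrt 3 / 6)"
  by (simp_all add: T0_vertex_def cis_thirds complex_eq_iff)

lemma coord_linear:
  "coord i (x + y) = coord i x + coord i y"
  "coord i (x - y) = coord i x - coord i y"
  "coord i (r *\<^sub>R x) = r * coord i x"
  by (simp_all add: coord_def inner_simps)

lemma coord_midpoint: "coord i (midpoint a b) = (coord i a + coord i b) / 2"
  by (simp add: midpoint_def coord_linear field_simps)

text \<open>Lets an argument single out one direction and treat the other two symmetrically, in
  place of a case split over all orders.\<close>

definition indices :: "nat \<Rightarrow> nat \<Rightarrow> nat \<Rightarrow> bool" where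
  "indices i j l \<longleftrightarrow> (i, j, l) \<in> {(1,2,3), (1,3,2), (2,1,3), (2,3,1), (3,1,2), (3,2,1)}"

lemma indices_exist:
  assumes "i \<in> {1, 2, 3}" obtains j l where "indices i j l"
  using assms unfolding indices_def by auto

lemma indices_exist2:
  assumes "i \<in> {1, 2, 3}" "j \<in> {1, 2, 3}" "i \<noteq> j" obtains l where "indices i j l"
  using assms unfolding indices_def by auto

lemma indices_perm:
  assumes "indices i j l"
  shows "indices i l j" "indices j i l" "indices j l i" "indices l i j" "indices l j i"
  using assms unfolding indices_def by auto

lemma indices_distinct:
  assumes "indices i j l"
  shows "i \<noteq> j" "i \<noteq> l" "j \<noteq> l" "i \<in> {1, 2, 3}" "j \<in> {1, 2, 3}" "l \<in> {1, 2, 3}"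
  using assms unfolding indices_def by auto

lemma indices_all:
  assumes "indices i j l"
  shows "(\<forall>h\<in>{1, 2, 3}. Q h) \<longleftrightarrow> Q i \<and> Q j \<and> Q l"
  using assms unfolding indices_def by auto

lemma indices_sum:
  assumes "indices i j l"
  shows "sum g {1, 2, 3} = g i + (g j + g l)"
proof -
  have "{1, 2, 3} = {i, j, l}" using assms by (auto simp: indices_def)
  then show ?thesis using indices_distinct[OF assms] by simp
qed

lemma coord_sum:
  assumes "indices i j l"
  shows "coord i x + coord j x + coord l x = 0"
  using assms unfolding indices_def by (auto simp: coord_explicit[simplified])

lemma coord_inject:
  assumes "indices i j l" "coord i x = coord i y" "coord j x = coord j y"
  shows "x = y"
proof -
  have "coord l x = coord l y"
    using coord_sum[OF assms(1), of x] coord_sum[OF assms(1), of y] assms by simp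
  then have "\<forall>h\<in>{1, 2, 3}. coord h x = coord h y"
    using assms indices_all[OF assms(1), where Q = "\<lambda>h. coord h x = coord h y"] by blast
  then have "coord 1 x = coord 1 y" "coord 2 x = coord 2 y" by simp_all
  then show ?thesis
    unfolding coord_explicit by (simp add: complex_eq_iff)
qed

lemma coord_T0_vertex:
  assumes "i \<in> {1, 2, 3}" "j \<in> {1, 2, 3}"
  shows "coord i (T0_vertex j) = (if i = j then - 2 else 1)"
  using assms by (auto simp: coord_explicit[simplified] T0_vertex_explicit[simplified])

text \<open>The vectors \<open>xi i\<close> have squared length 12 and lie 120 degrees apart, so
  they form a tight frame with constant 12 * 3 / 2 = 18.\<close>

lemma sum_coord_squares:
  "(coord 1 x)\<^sup>2 + (coord 2 x)\<^sup>2 + (coord 3 x)\<^sup>2 = 18 * (norm x)\<^sup>2"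
  unfolding coord_explicit cmod_power2 by (simp add: power2_eq_square algebra_simps)

lemma sum_coord_squares_indices:
  assumes "indices i j l"
  shows "(coord i x)\<^sup>2 + (coord j x)\<^sup>2 + (coord l x)\<^sup>2 = 18 * (norm x)\<^sup>2"
  using assms sum_coord_squares[of x] unfolding indices_def by auto

lemma abs_coord_le:
  assumes "i \<in> {1, 2, 3}" shows "\<bar>coord i x\<bar> \<le> 5 * norm x"
proof -
  obtain j l where ijl: "indices i j l" using indices_exist assms by blast
  have "(coord i x)\<^sup>2 \<le> 18 * (norm x)\<^sup>2"
    using sum_coord_squares_indices[OF ijl, of x]
    by (smt (verit) zero_le_power2)
  also have "\<dots> \<le> (5 * norm x)\<^sup>2" by (simp add: power_mult_distrib)
  finally show ?thesis by (metis abs_le_square_iff abs_mult abs_norm_cancel abs_numeral)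
qed

text \<open>\<open>T0_vertex h\<close> is normal to the line \<open>coord h = c\<close>, and \<open>coord h (T0_vertex h) = - 2\<close>, so this is
  the reflection in that line.\<close>

definition reflect :: "nat \<Rightarrow> real \<Rightarrow> complex \<Rightarrow> complex" where
  "reflect h c x = x + (coord h x - c) *\<^sub>R T0_vertex h"

lemma coord_reflect:
  assumes "h \<in> {1, 2, 3}"
  shows "coord h (reflect h c x) = 2 * c - coord h x"
    and "\<lbrakk>j \<in> {1, 2, 3}; j \<noteq> h\<rbrakk> \<Longrightarrow> coord j (reflect h c x) = coord j x + coord h x - c"
  using assms by (auto simp: reflect_def coord_linear coord_T0_vertex)

lemma reflect_midpoint: "reflect h c (midpoint a b) = midpoint (reflect h c a) (reflect h c b)"
  by (simp add: reflect_def midpoint_def coord_linear complex_eq_iff field_simps)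

lemma reflect_closed_segment:
  "reflect h c ` closed_segment a b = closed_segment (reflect h c a) (reflect h c b)"
proof -
  have "linear (\<lambda>x. x + coord h x *\<^sub>R T0_vertex h)"
    by (rule linearI) (simp_all add: coord_linear algebra_simps)
  then have l: "(\<lambda>x. x + coord h x *\<^sub>R T0_vertex h) ` closed_segment a b
    = closed_segment (a + coord h a *\<^sub>R T0_vertex h) (b + coord h b *\<^sub>R T0_vertex h)"
    by (rule closed_segment_linear_image[symmetric])
  have r: "reflect h c x = - c *\<^sub>R T0_vertex h + (x + coord h x *\<^sub>R T0_vertex h)" for x
    by (simp add: reflect_def algebra_simps)
  have "reflect h c ` closed_segment a b
      = (+) (- c *\<^sub>R T0_vertex h) ` (\<lambda>x. x + coord h x *\<^sub>R T0_vertex h) ` closed_segment a b"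
    unfolding r image_image ..
  then show ?thesis unfolding l r closed_segment_translation by simp
qed

text \<open>Both given points have \<open>h\<close>-coordinate \<open>c\<close>, so the line through
  them is the mirror of \<open>reflect h c\<close>.\<close>

lemma line_reflection_eq_reflect:
  assumes "indices h j l" "c \<noteq> 0"
  shows "line_reflection (c *\<^sub>R T0_vertex j) (c *\<^sub>R T0_vertex l) x = reflect h c x"
proof -
  have s: "sqrt 3 * sqrt 3 = 3" "\<And>y. sqrt 3 * (sqrt 3 * y) = 3 * y" by (auto simp flip: mult.assoc)
  \<comment> \<open>The sides of \<open>T0\<close> have length 1, so dividing by
    \<open>cnj d\<close> is multiplying by \<open>d\<close>; the real factor \<open>c\<close>
    cancels.\<close>
  define d where "d = T0_vertex l - T0_vertex j"
  have d: "d * cnj d = 1"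
    using assms(1) unfolding d_def indices_def
    by (auto simp: T0_vertex_explicit[simplified] complex_eq_iff s field_simps)
  then have [simp]: "d \<noteq> 0" "cnj d \<noteq> 0" by auto
  have "inverse (cnj d) = d"
    using d by (metis inverse_unique mult.commute)
  then have "line_reflection (c *\<^sub>R T0_vertex j) (c *\<^sub>R T0_vertex l) x
    = c *\<^sub>R T0_vertex j + d * d * cnj (x - c *\<^sub>R T0_vertex j)"
    unfolding line_reflection_def using assms(2)
    by (simp add: d_def[symmetric] scaleR_diff_right[symmetric] scaleR_conv_of_real divide_inverse
        del: complex_cnj_diff flip: right_diff_distrib)
  also have "\<dots> = reflect h c x"
    using assms(1) unfolding d_def indices_def reflect_def
    by (auto simp: T0_vertex_explicit[simplified] coord_explicit[simplified] complex_eq_iff s field_simps)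
  finally show ?thesis .
qed

section \<open>Folding the scaled triangles\<close>

lemma T0_vertex_sum:
  assumes "indices i j l"
  shows "T0_vertex i + T0_vertex j = - T0_vertex l"
  using assms unfolding indices_def by (auto simp: T0_vertex_explicit[simplified] complex_eq_iff)

lemma T0_eq: "T0 = {x. \<forall>i\<in>{1, 2, 3}. coord i x \<le> 1}"
proof (intro set_eqI iffI)
  fix x assume "x \<in> T0"
  then obtain u v w where h: "u \<ge> 0" "v \<ge> 0" "w \<ge> 0" "u + v + w = 1"
    and x: "x = u *\<^sub>R T0_vertex 1 + v *\<^sub>R T0_vertex 2 + w *\<^sub>R T0_vertex 3"
    unfolding T0_def convex_hull_3 by blast
  show "x \<in> {x. \<forall>i\<in>{1, 2, 3}. coord i x \<le> 1}"
    unfolding x using h by (auto simp: coord_linear coord_T0_vertex)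
next
  fix x assume a: "x \<in> {x. \<forall>i\<in>{1, 2, 3}. coord i x \<le> 1}"
  \<comment> \<open>Barycentric coordinates: vertex \<open>i\<close> has \<open>i\<close>-coordinate
    -2 and the others have 1, so \<open>coord i\<close> is 1 minus three times the weight of vertex
    \<open>i\<close>.\<close>
  define u v w where uvw: "u = (1 - coord 1 x) / 3" "v = (1 - coord 2 x) / 3" "w = (1 - coord 3 x) / 3"
  have i: "indices 1 2 3" by (simp add: indices_def)
  have s: "u + v + w = 1"
    using coord_sum[OF i, of x] by (simp add: uvw field_simps)
  have "coord 1 x = coord 1 (u *\<^sub>R T0_vertex 1 + v *\<^sub>R T0_vertex 2 + w *\<^sub>R T0_vertex 3)"
    "coord 2 x = coord 2 (u *\<^sub>R T0_vertex 1 + v *\<^sub>R T0_vertex 2 + w *\<^sub>R T0_vertex 3)"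
    using s by (auto simp: coord_linear coord_T0_vertex[simplified]) (auto simp: uvw field_simps)
  then have "x = u *\<^sub>R T0_vertex 1 + v *\<^sub>R T0_vertex 2 + w *\<^sub>R T0_vertex 3"
    by (rule coord_inject[OF i])
  moreover have "u \<ge> 0" "v \<ge> 0" "w \<ge> 0" using a by (auto simp: uvw)
  ultimately show "x \<in> T0" unfolding T0_def convex_hull_3 using s by blast
qed

text \<open>Division by the signed power covers both orientations of the scaled triangle with one
  inequality.\<close>

lemma paper_eq: "paper k = {x. \<forall>i\<in>{1, 2, 3}. coord i x / (- 2) ^ k \<le> 1}"
proof (intro set_eqI iffI)
  fix x assume "x \<in> paper k"
  then show "x \<in> {x. \<forall>i\<in>{1, 2, 3}. coord i x / (- 2) ^ k \<le> 1}"
    unfolding paper_def T0_eq by (auto simp: coord_linear)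
next
  fix x assume a: "x \<in> {x. \<forall>i\<in>{1, 2, 3}. coord i x / (- 2) ^ k \<le> 1}"
  have "x = (- 2) ^ k *\<^sub>R ((1 / (- 2) ^ k) *\<^sub>R x)" by simp
  moreover have "(1 / (- 2) ^ k) *\<^sub>R x \<in> T0"
    using a unfolding T0_eq by (auto simp: coord_linear)
  ultimately show "x \<in> paper k" unfolding paper_def by blast
qed

text \<open>The corner of \<open>paper (Suc k)\<close> cut off by the midsegment of direction
  \<open>h\<close>. Measured in units of \<open>(-2)^k\<close>, the sides of the large triangle are
  at -2 and those of the central triangle at 1.\<close>

definition corner_region :: "nat \<Rightarrow> nat \<Rightarrow> complex set" where
  "corner_region k h = {x. 1 \<le> coord h x / (- 2) ^ k \<and> (\<forall>j\<in>{1, 2, 3}. - 2 \<le> coord j x / (- 2) ^ k)}"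

text \<open>The vertices of \<open>T0\<close> sum to zero, so the medial triangle is the image of
  the whole one under ratio -1/2. This is why folding \<open>(-2)^(k+1) T_0\<close> gives
  \<open>(-2)^k T_0\<close>.\<close>

lemma midpoint_paper_vertex:
  assumes "indices i j l"
  shows "midpoint (paper_vertex (Suc k) i) (paper_vertex (Suc k) j) = (- 2) ^ k *\<^sub>R T0_vertex l"
proof -
  have "midpoint (paper_vertex (Suc k) i) (paper_vertex (Suc k) j)
      = (- ((- 2) ^ k)) *\<^sub>R (T0_vertex i + T0_vertex j)"
    by (simp add: midpoint_def paper_vertex_def complex_eq_iff algebra_simps)
  then show ?thesis using T0_vertex_sum[OF assms] by simp
qed

lemma corner_eq_region:
  assumes "indices h j l"
  shows "corner (paper_vertex (Suc k) h) (paper_vertex (Suc k) j) (paper_vertex (Suc k) l)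
    = corner_region k h"
proof -
  define c :: real where "c = (- 2) ^ k"
  have c: "c \<noteq> 0" by (simp add: c_def)
  note ih = indices_distinct[OF assms]
  note m = midpoint_paper_vertex[OF assms, of k]
    midpoint_paper_vertex[OF indices_perm(1)[OF assms], of k]
  have hull: "corner (paper_vertex (Suc k) h) (paper_vertex (Suc k) j) (paper_vertex (Suc k) l)
    = {u *\<^sub>R ((- 2 * c) *\<^sub>R T0_vertex h) + v *\<^sub>R (c *\<^sub>R T0_vertex l) + w *\<^sub>R (c *\<^sub>R T0_vertex j) | u v w.
        0 \<le> u \<and> 0 \<le> v \<and> 0 \<le> w \<and> u + v + w = 1}"
    unfolding corner_def m convex_hull_3 by (simp add: paper_vertex_def c_def)
  have reg: "x \<in> corner_region k h \<longleftrightarrow> 1 \<le> coord h x / c \<and> - 2 \<le> coord j x / c \<and> - 2 \<le> coord l x / c" for x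
    using indices_all[OF assms, where Q = "\<lambda>j. - 2 \<le> coord j x / c"]
    unfolding corner_region_def c_def[symmetric] by auto
  show ?thesis
  proof (intro set_eqI iffI)
    fix x assume "x \<in> corner (paper_vertex (Suc k) h) (paper_vertex (Suc k) j) (paper_vertex (Suc k) l)"
    then obtain u v w where uvw: "0 \<le> u" "0 \<le> v" "0 \<le> w" "u + v + w = 1"
      and x: "x = u *\<^sub>R ((- 2 * c) *\<^sub>R T0_vertex h) + v *\<^sub>R (c *\<^sub>R T0_vertex l) + w *\<^sub>R (c *\<^sub>R T0_vertex j)"
      unfolding hull by blast
    have "coord h x = c * (4 * u + v + w)" "coord j x = c * (- 2 * u + v - 2 * w)"
      "coord l x = c * (- 2 * u - 2 * v + w)"
      unfolding x using ih by (auto simp: coord_linear coord_T0_vertex algebra_simps)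
    then have "coord h x / c = 4 * u + v + w" "coord j x / c = - 2 * u + v - 2 * w"
      "coord l x / c = - 2 * u - 2 * v + w"
      using c by simp_all
    then show "x \<in> corner_region k h" unfolding reg using uvw by simp
  next
    fix x assume a: "x \<in> corner_region k h"
    \<comment> \<open>Weights with respect to the vertices of the corner. In units of
      \<open>c\<close> their \<open>h\<close>-coordinates are 4, 1, 1, their
      \<open>j\<close>-coordinates -2, 1, -2 and their \<open>l\<close>-coordinates -2, -2,
      1.\<close>
    define u v w where uvw: "u = (coord h x / c - 1) / 3" "v = (coord j x / c + 2) / 3"
      "w = (coord l x / c + 2) / 3"
    have "coord h x / c + coord j x / c + coord l x / c = 0"
      using coord_sum[OF assms, of x] c by (simp add: add_divide_distrib[symmetric])
    moreover have "p + q + r = 0 \<Longrightarrow> (p - 1) / 3 + (q + 2) / 3 + (r + 2) / 3 = 1" for p q r :: real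
      by (simp add: field_simps)
    ultimately have s: "u + v + w = 1" unfolding uvw by blast
    define y where "y = u *\<^sub>R ((- 2 * c) *\<^sub>R T0_vertex h) + v *\<^sub>R (c *\<^sub>R T0_vertex l) + w *\<^sub>R (c *\<^sub>R T0_vertex j)"
    have "coord h y = c * (4 * u + v + w)" "coord j y = c * (- 2 * u + v - 2 * w)"
      unfolding y_def using ih by (auto simp: coord_linear coord_T0_vertex algebra_simps)
    moreover have "4 * u + v + w = coord h x / c" "- 2 * u + v - 2 * w = coord j x / c"
    proof -
      have "3 * ((t - 1) / 3) = t - 1" "3 * ((t + 2) / 3) = t + 2" for t :: real
        by (simp_all add: field_simps)
      then have "3 * u = coord h x / c - 1" "3 * v = coord j x / c + 2" unfolding uvw by blast+
      then show "4 * u + v + w = coord h x / c" "- 2 * u + v - 2 * w = coord j x / c"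
        using s by linarith+
    qed
    ultimately have "coord h x = coord h y" "coord j x = coord j y" using c by simp_all
    then have "x = y" by (rule coord_inject[OF assms])
    moreover have "u \<ge> 0" "v \<ge> 0" "w \<ge> 0" using a unfolding reg by (auto simp: uvw)
    ultimately show "x \<in> corner (paper_vertex (Suc k) h) (paper_vertex (Suc k) j) (paper_vertex (Suc k) l)"
      unfolding hull y_def using s by blast
  qed
qed

lemma indices_cyclic: "indices 1 2 3" "indices 2 3 1" "indices 3 1 2"
  by (simp_all add: indices_def)

lemma paper_corners_eq: "paper_corners (Suc k) = corner_region k ` {1, 2, 3}"
  unfolding paper_corners_def corners_def
  by (simp add: corner_eq_region indices_cyclic[simplified])

lemma paper_fold_region:
  assumes "h \<in> {1, 2, 3}" "x \<in> corner_region k h"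
  shows "paper_fold (Suc k) x = reflect h ((- 2) ^ k) x"
proof -
  define c :: real where "c = (- 2) ^ k"
  have c: "c \<noteq> 0" by (simp add: c_def)
  \<comment> \<open>\<open>fold_map\<close> tests the corners in a fixed order. This is harmless:
    two corners share only a vertex of the central triangle, which both reflections fix.\<close>
  have eq: "reflect h c x = reflect j c x" if j: "j \<in> {1, 2, 3}" "x \<in> corner_region k j" for j
  proof (cases "j = h")
    case False
    then obtain l where i: "indices h j l" using indices_exist2 assms(1) j(1) by metis
    have "coord h x / c + coord j x / c + coord l x / c = 0"
      using coord_sum[OF i, of x] c by (simp add: add_divide_distrib[symmetric])
    moreover have "1 \<le> coord h x / c" "1 \<le> coord j x / c" "- 2 \<le> coord l x / c"
      using assms(2) j(2) indices_distinct[OF i] unfolding corner_region_def c_def by auto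
    ultimately have "coord h x / c = 1" "coord j x / c = 1" by linarith+
    then have "coord h x = c" "coord j x = c" using c by simp_all
    then show ?thesis by (simp add: reflect_def)
  qed simp
  have refl: "line_reflection (midpoint (paper_vertex (Suc k) i) (paper_vertex (Suc k) j))
     (midpoint (paper_vertex (Suc k) i) (paper_vertex (Suc k) l)) x = reflect i c x"
    if "indices i j l" for i j l
    unfolding midpoint_paper_vertex[OF that] midpoint_paper_vertex[OF indices_perm(1)[OF that]]
    using line_reflection_eq_reflect[OF indices_perm(1)[OF that]] c by (simp add: c_def)
  have "paper_fold (Suc k) x = (if x \<in> corner_region k 1 then reflect 1 c x
     else if x \<in> corner_region k 2 then reflect 2 c x
     else if x \<in> corner_region k 3 then reflect 3 c x else x)"
    unfolding paper_fold_def fold_map_def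
    by (simp only: corner_eq_region indices_cyclic refl)
  moreover have "x \<in> corner_region k 1 \<or> x \<in> corner_region k 2 \<or> x \<in> corner_region k 3"
    using assms by blast
  ultimately show ?thesis using eq[of 1] eq[of 2] eq[of 3] by (auto simp: c_def)
qed

text \<open>A point of the central triangle can belong to a corner only if it is on the fold line,
  which the reflection fixes pointwise.\<close>

lemma paper_fold_central:
  assumes "\<forall>h\<in>{1, 2, 3}. coord h x / (- 2) ^ k \<le> 1"
  shows "paper_fold (Suc k) x = x"
proof (cases "\<exists>h\<in>{1, 2, 3}. x \<in> corner_region k h")
  case True
  then obtain h where h: "h \<in> {1, 2, 3}" "x \<in> corner_region k h" by blast
  then have "coord h x / (- 2) ^ k = 1" using assms unfolding corner_region_def by force
  then have "coord h x = (- 2) ^ k" by simp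
  then show ?thesis using paper_fold_region[OF h] by (simp add: reflect_def)
next
  case False
  then have "x \<notin> corner_region k 1" "x \<notin> corner_region k 2" "x \<notin> corner_region k 3" by auto
  then show ?thesis
    unfolding paper_fold_def fold_map_def by (simp only: corner_eq_region indices_cyclic if_False)
qed

lemma midsegment_eq:
  assumes "indices h j l"
  shows "closed_segment (midpoint (paper_vertex (Suc k) h) (paper_vertex (Suc k) j))
    (midpoint (paper_vertex (Suc k) h) (paper_vertex (Suc k) l))
    = {x. coord h x = (- 2) ^ k \<and> (\<forall>j\<in>{1, 2, 3}. - 2 \<le> coord j x / (- 2) ^ k)}"
proof -
  define c :: real where "c = (- 2) ^ k"
  have c: "c \<noteq> 0" by (simp add: c_def)
  note ih = indices_distinct[OF assms]
  note m = midpoint_paper_vertex[OF assms, of k]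
    midpoint_paper_vertex[OF indices_perm(1)[OF assms], of k]
  have all: "(\<forall>j\<in>{1, 2, 3}. - 2 \<le> coord j x / c)
     \<longleftrightarrow> - 2 \<le> coord h x / c \<and> - 2 \<le> coord j x / c \<and> - 2 \<le> coord l x / c" for x
    using indices_all[OF assms, where Q = "\<lambda>j. - 2 \<le> coord j x / c"] .
  have "x \<in> closed_segment (c *\<^sub>R T0_vertex l) (c *\<^sub>R T0_vertex j) \<longleftrightarrow>
      coord h x = c \<and> (\<forall>j\<in>{1, 2, 3}. - 2 \<le> coord j x / c)" for x
  proof
    assume "x \<in> closed_segment (c *\<^sub>R T0_vertex l) (c *\<^sub>R T0_vertex j)"
    then obtain u where u: "0 \<le> u" "u \<le> 1"
      and x: "x = (1 - u) *\<^sub>R (c *\<^sub>R T0_vertex l) + u *\<^sub>R (c *\<^sub>R T0_vertex j)"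
      unfolding in_segment by blast
    have "coord h x = c" "coord j x = c * (1 - 3 * u)" "coord l x = c * (3 * u - 2)"
      unfolding x using ih by (auto simp: coord_linear coord_T0_vertex algebra_simps)
    then have "coord h x = c" "coord h x / c = 1" "coord j x / c = 1 - 3 * u" "coord l x / c = 3 * u - 2"
      using c by simp_all
    then show "coord h x = c \<and> (\<forall>j\<in>{1, 2, 3}. - 2 \<le> coord j x / c)"
      unfolding all using u by simp
  next
    assume a: "coord h x = c \<and> (\<forall>j\<in>{1, 2, 3}. - 2 \<le> coord j x / c)"
    \<comment> \<open>Along the segment the \<open>l\<close>-coordinate in units of \<open>c\<close>
      is \<open>3 * u - 2\<close>.\<close>
    define u where "u = (coord l x / c + 2) / 3"
    have s: "coord h x / c + coord j x / c + coord l x / c = 0"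
      using coord_sum[OF assms, of x] c by (simp add: add_divide_distrib[symmetric])
    moreover have "coord h x / c = 1" using a c by simp
    ultimately have u: "0 \<le> u" "u \<le> 1" using a unfolding all u_def by auto
    define y where "y = (1 - u) *\<^sub>R (c *\<^sub>R T0_vertex l) + u *\<^sub>R (c *\<^sub>R T0_vertex j)"
    have "coord h y = c" "coord l y = c * (3 * u - 2)"
      unfolding y_def using ih by (auto simp: coord_linear coord_T0_vertex algebra_simps)
    moreover have "3 * ((t + 2) / 3) - 2 = t" for t :: real by (simp add: field_simps)
    then have "3 * u - 2 = coord l x / c" unfolding u_def by blast
    ultimately have "coord h x = coord h y" "coord l x = coord l y" using c a by simp_all
    then have "x = y" by (rule coord_inject[OF indices_perm(1)[OF assms]])
    then show "x \<in> closed_segment (c *\<^sub>R T0_vertex l) (c *\<^sub>R T0_vertex j)"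
      unfolding in_segment y_def using u by blast
  qed
  then show ?thesis unfolding m c_def[symmetric] by blast
qed

lemma paper_midsegments_eq:
  "paper_midsegments (Suc k) =
    (\<lambda>h. {x. coord h x = (- 2) ^ k \<and> (\<forall>j\<in>{1, 2, 3}. - 2 \<le> coord j x / (- 2) ^ k)}) ` {1, 2, 3}"
  unfolding paper_midsegments_def midsegments_def
  by (simp only: midsegment_eq indices_cyclic image_insert image_empty)

section \<open>The colour of an edge\<close>

text \<open>The vertices of the grid. As coordinates sum to zero, being 1 modulo 3 in two directions
  forces the third.\<close>

definition lattice_point :: "complex \<Rightarrow> bool" where
  "lattice_point x \<longleftrightarrow> (\<forall>i\<in>{1, 2, 3}. \<exists>n::int. coord i x = 3 * of_int n + 1)"

text \<open>With equal \<open>i\<close>-coordinates, differences of 3 in the two other directions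
  mean length 1, because 9 + 9 = 18.\<close>

definition grid_edge :: "nat \<Rightarrow> complex \<Rightarrow> complex \<Rightarrow> bool" where
  "grid_edge i a b \<longleftrightarrow> i \<in> {1, 2, 3} \<and> lattice_point a \<and> lattice_point b \<and> coord i a = coord i b \<and>
     (\<forall>j\<in>{1, 2, 3} - {i}. \<bar>coord j a - coord j b\<bar> = 3)"

definition cell_coord :: "nat \<Rightarrow> nat \<Rightarrow> complex \<Rightarrow> real" where
  "cell_coord l i x = (coord i x / (- 2) ^ l - 1) / 3"

text \<open>In the \<open>(-2)\<^sup>l\<close>-scaled grid, \<open>\<lceil>cell_coord l i x\<rceil>\<close> numbers the strip between lines of
  direction \<open>i\<close> that contains \<open>x\<close>. The three strip numbers of a cell sum to \<open>0\<close> if it is a translate of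
  \<open>(-2)\<^sup>l T\<^sub>0\<close>, and to \<open>1\<close> if it is upside down.\<close>

definition upright :: "nat \<Rightarrow> complex \<Rightarrow> bool" where
  "upright l x \<longleftrightarrow> (\<Sum>i\<in>{1, 2, 3}. \<lceil>cell_coord l i x\<rceil>) = 0"

text \<open>-2 is 1 modulo 3. Hence every line of the grid scaled by \<open>(-2)^k\<close> is again
  a line of the grid.\<close>

lemma minus_two_power_mod_3: "\<exists>z::int. (- 2) ^ k = (3 * of_int z + 1 :: real)"
proof (induction k)
  case (Suc k)
  then obtain z :: int where "(- 2) ^ k = (3 * of_int z + 1 :: real)" by blast
  then have "(- 2) ^ Suc k = (3 * of_int (- 2 * z - 1) + 1 :: real)" by simp
  then show ?case by blast
qed (auto intro: exI[of _ 0])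

lemma cell_coord_sum:
  assumes "indices i j k"
  shows "cell_coord l i x + cell_coord l j x + cell_coord l k x = - 1"
proof -
  have "coord i x / (- 2) ^ l + coord j x / (- 2) ^ l + coord k x / (- 2) ^ l = 0"
    using coord_sum[OF assms, of x] by (simp add: add_divide_distrib[symmetric])
  moreover have "p + q + r = 0 \<Longrightarrow> (p - 1) / 3 + (q - 1) / 3 + (r - 1) / 3 = - 1" for p q r :: real
    by (simp add: field_simps)
  ultimately show ?thesis unfolding cell_coord_def by blast
qed

lemma ceiling_nonint: "t \<notin> \<int> \<Longrightarrow> \<lceil>t\<rceil> = \<lfloor>t\<rfloor> + 1" for t :: real
  by (metis Ints_of_int ceiling_altdef)

text \<open>For \<open>l \<le> k\<close> the mirror is a line of the \<open>(-2)^l\<close>-scaled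
  grid, so the reflection preserves that grid and exchanges its two kinds of cells. The strip
  numbers are computed off the lines, where ceilings behave well under negation.\<close>

lemma upright_reflect:
  assumes h: "h \<in> {1, 2, 3}" and "l \<le> k"
    and nonint: "\<forall>j\<in>{1, 2, 3}. cell_coord l j x \<notin> \<int>"
  shows "upright l (reflect h ((- 2) ^ k) x) \<longleftrightarrow> \<not> upright l x"
proof -
  define c :: real where "c = (- 2) ^ k"
  define C :: real where "C = (- 2) ^ l"
  obtain z :: int where z: "(- 2) ^ (k - l) = (3 * of_int z + 1 :: real)"
    using minus_two_power_mod_3 by blast
  have "c = C * (- 2) ^ (k - l)" unfolding c_def C_def using \<open>l \<le> k\<close> by (simp flip: power_add)
  then have cC: "c / C = 3 * of_int z + 1" using z by (simp add: C_def)
  obtain i j where ind: "indices h i j" using indices_exist h by blast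
  note d = indices_distinct[OF ind]
  let ?y = "reflect h c x"
  have sum: "cell_coord l h x + cell_coord l i x + cell_coord l j x = - 1"
    by (rule cell_coord_sum[OF ind])
  have "coord h ?y / C = 2 * (c / C) - coord h x / C"
    using coord_reflect(1)[OF h] by (simp add: diff_divide_distrib)
  moreover have "p = 2 * (3 * t + 1) - q \<Longrightarrow> (p - 1) / 3 = 2 * t - (q - 1) / 3" for p q t :: real
    by (simp add: field_simps)
  ultimately have h': "cell_coord l h ?y = of_int (2 * z) - cell_coord l h x"
    unfolding cell_coord_def C_def[symmetric] cC by simp
  \<comment> \<open>The two remaining directions are exchanged and negated, up to an integer
    shift.\<close>
  have other: "cell_coord l i' ?y = of_int (- 1 - z) - cell_coord l j' x"
    if "indices h i' j'" for i' j'
  proof -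
    note d' = indices_distinct[OF that]
    have "coord i' ?y / C = coord i' x / C + coord h x / C - c / C"
      using coord_reflect(2)[OF h, of i'] d' by (auto simp: diff_divide_distrib add_divide_distrib)
    moreover have "p = q + r - (3 * t + 1) \<Longrightarrow> (p - 1) / 3 = (q - 1) / 3 + (r - 1) / 3 - t" for p q r t :: real
      by (simp add: field_simps)
    ultimately have "cell_coord l i' ?y = cell_coord l i' x + cell_coord l h x - of_int z"
      unfolding cell_coord_def C_def[symmetric] cC by blast
    then show ?thesis using cell_coord_sum[OF that, of l x] by simp
  qed
  have minus: "\<lceil>of_int m - t\<rceil> = m + 1 - \<lceil>t\<rceil>" if "t \<notin> \<int>" for m :: int and t :: real
    using ceiling_nonint[OF that] by (simp add: ceiling_diff_of_int ceiling_def)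
  have n: "cell_coord l h x \<notin> \<int>" "cell_coord l i x \<notin> \<int>" "cell_coord l j x \<notin> \<int>"
    using nonint d by blast+
  have "(\<Sum>i\<in>{1, 2, 3}. \<lceil>cell_coord l i ?y\<rceil>) = 1 - (\<Sum>i\<in>{1, 2, 3}. \<lceil>cell_coord l i x\<rceil>)"
    unfolding indices_sum[OF ind] h' other[OF ind] other[OF indices_perm(1)[OF ind]]
      minus[OF n(1)] minus[OF n(2)] minus[OF n(3)] by simp
  \<comment> \<open>The cell coordinates sum to -1 and each ceiling adds more than 0 and less than
    1, so the integer sum lies strictly between -1 and 2.\<close>
  moreover have "(\<Sum>i\<in>{1, 2, 3}. \<lceil>cell_coord l i x\<rceil>) \<in> {0, 1}"
  proof -
    have "cell_coord l h x < of_int \<lceil>cell_coord l h x\<rceil>"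
      unfolding ceiling_nonint[OF n(1)] by linarith
    then have "- 1 < (\<Sum>i\<in>{1, 2, 3}. \<lceil>cell_coord l i x\<rceil>)"
      unfolding indices_sum[OF ind] using sum by linarith
    moreover have "(\<Sum>i\<in>{1, 2, 3}. \<lceil>cell_coord l i x\<rceil>) < 2"
      unfolding indices_sum[OF ind] using sum by linarith
    ultimately show ?thesis by auto
  qed
  ultimately show ?thesis unfolding upright_def c_def by auto
qed

section \<open>Edges and fold lines\<close>

lemma grid_edge_commute: "grid_edge i a b \<Longrightarrow> grid_edge i b a"
  unfolding grid_edge_def by (simp add: abs_minus_commute)

text \<open>Parity: in direction \<open>i\<close> a line of the \<open>(-2)^(n+1)\<close>-scaled
  grid would force \<open>w\<close> even; in another direction the coordinates of the two ends have
  an odd sum, whereas the midpoint on such a line would make it even.\<close>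

lemma grid_edge_midpoint_nonint:
  assumes e: "grid_edge i a b" and m: "coord i a = (- 2) ^ n * of_int w" and w: "odd w"
  shows "\<forall>j\<in>{1, 2, 3}. cell_coord (Suc n) j (midpoint a b) \<notin> \<int>"
proof
  fix j :: nat assume j: "j \<in> {1, 2, 3}"
  show "cell_coord (Suc n) j (midpoint a b) \<notin> \<int>"
  proof
    assume "cell_coord (Suc n) j (midpoint a b) \<in> \<int>"
    then obtain t :: int where t: "cell_coord (Suc n) j (midpoint a b) = of_int t"
      by (auto elim: Ints_cases)
    show False
    proof (cases "j = i")
      case True
      have "coord i (midpoint a b) = (- 2) ^ n * of_int w"
        using e m by (simp add: coord_midpoint grid_edge_def)
      then have "coord i (midpoint a b) / (- 2) ^ Suc n = - (of_int w / 2)" by simp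
      then have "real_of_int w = of_int (- 6 * t - 2)"
        using t True unfolding cell_coord_def by simp
      then have "w = - 6 * t - 2" by linarith
      then show False using w by simp
    next
      case False
      obtain p q :: int where p: "coord j a = 3 * of_int p + 1" and q: "coord j b = 3 * of_int q + 1"
        using e j unfolding grid_edge_def lattice_point_def by blast
      have "\<bar>coord j a - coord j b\<bar> = 3" using e j False unfolding grid_edge_def by auto
      then have "q = p + 1 \<or> q = p - 1" using p q by linarith
      moreover have "coord j (midpoint a b) = (- 2) ^ Suc n * (3 * of_int t + 1)"
      proof -
        have "(p - 1) / 3 = t \<Longrightarrow> p = 3 * t + 1" for p t :: real by (simp add: field_simps)
        then have "coord j (midpoint a b) / (- 2) ^ Suc n = 3 * of_int t + 1"
          using t unfolding cell_coord_def by blast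
        then show ?thesis by (simp add: field_simps)
      qed
      then have "3 * of_int p + 1 + (3 * of_int q + 1) = real_of_int (2 * ((- 2) ^ Suc n * (3 * t + 1)))"
        unfolding coord_midpoint p q by simp
      then have "3 * p + 1 + (3 * q + 1) = 2 * ((- 2) ^ Suc n * (3 * t + 1))" by linarith
      then have "even (3 * p + 1 + (3 * q + 1))" by simp
      ultimately show False by auto
    qed
  qed
qed

lemma lattice_point_reflect:
  assumes "lattice_point x" "h \<in> {1, 2, 3}"
  shows "lattice_point (reflect h ((- 2) ^ k) x)"
  unfolding lattice_point_def
proof
  fix j :: nat assume j: "j \<in> {1, 2, 3}"
  obtain z :: int where z: "(- 2) ^ k = (3 * of_int z + 1 :: real)"
    using minus_two_power_mod_3 by blast
  obtain p q :: int where p: "coord h x = 3 * of_int p + 1" and q: "coord j x = 3 * of_int q + 1"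
    using assms j unfolding lattice_point_def by blast
  show "\<exists>n::int. coord j (reflect h ((- 2) ^ k) x) = 3 * of_int n + 1"
  proof (cases "j = h")
    case True
    then have "coord j (reflect h ((- 2) ^ k) x) = 3 * of_int (2 * z - p) + 1"
      using coord_reflect(1)[OF assms(2)] p z by simp
    then show ?thesis by blast
  next
    case False
    then have "coord j (reflect h ((- 2) ^ k) x) = 3 * of_int (q + p - z) + 1"
      using coord_reflect(2)[OF assms(2) j] p q z by simp
    then show ?thesis by blast
  qed
qed

lemma grid_edge_reflect_same:
  assumes "grid_edge i a b"
  shows "grid_edge i (reflect i ((- 2) ^ k) a) (reflect i ((- 2) ^ k) b)"
  using assms unfolding grid_edge_def
  by (auto simp: lattice_point_reflect coord_reflect)

text \<open>A reflection in direction \<open>h\<close> exchanges the two other directions; the new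
  coordinate follows from the vanishing sum.\<close>

lemma grid_edge_reflect_other:
  assumes "grid_edge i a b" "indices h i l"
  shows "grid_edge l (reflect h ((- 2) ^ k) a) (reflect h ((- 2) ^ k) b)"
    "coord l (reflect h ((- 2) ^ k) a) = - coord i a - (- 2) ^ k"
proof -
  note d = indices_distinct[OF assms(2)]
  define c :: real where "c = (- 2) ^ k"
  have s: "coord l (reflect h c x) = - coord i x - c" "coord h (reflect h c x) = 2 * c - coord h x"
    "coord i (reflect h c x) = - coord l x - c" for x
    using coord_sum[OF assms(2), of x] coord_reflect(2)[of h] coord_reflect(1)[of h] d by auto
  have "\<forall>j\<in>{1,2,3}. j \<noteq> l \<longrightarrow> \<bar>coord j (reflect h c a) - coord j (reflect h c b)\<bar> = 3"
    unfolding indices_all[OF assms(2)] s using assms(1) d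
    unfolding grid_edge_def by (auto simp: abs_minus_commute)
  moreover have "coord i a = coord i b" using assms(1) by (simp add: grid_edge_def)
  ultimately show "grid_edge l (reflect h ((- 2) ^ k) a) (reflect h ((- 2) ^ k) b)"
    using assms(1) d s unfolding grid_edge_def c_def
    by (auto simp: lattice_point_reflect)
  show "coord l (reflect h ((- 2) ^ k) a) = - coord i a - (- 2) ^ k"
    using s by (simp add: c_def)
qed

text \<open>No edge crosses a fold line: the coordinates of both ends and of the line are 1 modulo
  3, and the ends differ by at most 3.\<close>

lemma grid_edge_one_side:
  assumes "grid_edge i a b" "h \<in> {1, 2, 3}" "coord h a / (- 2) ^ k < 1"
  shows "coord h b / (- 2) ^ k \<le> 1"
proof -
  obtain z :: int where z: "(- 2) ^ k = (3 * of_int z + 1 :: real)"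
    using minus_two_power_mod_3 by blast
  obtain p q :: int where p: "coord h a = 3 * of_int p + 1" and q: "coord h b = 3 * of_int q + 1"
    using assms unfolding grid_edge_def lattice_point_def by blast
  have "\<bar>coord h a - coord h b\<bar> \<le> 3"
    using assms unfolding grid_edge_def by (cases "h = i") auto
  then have pq: "\<bar>p - q\<bar> \<le> 1" unfolding p q by linarith
  \<comment> \<open>The sign of \<open>(-2)^k\<close> decides which side of the line the inequality
    describes.\<close>
  show ?thesis
  proof (cases "3 * of_int z + 1 > (0::real)")
    case True
    then have "3 * of_int p + 1 < (3 * of_int z + 1 :: real)"
      using assms(3) unfolding z p by (simp add: divide_less_eq)
    then have "p < z" by simp
    then have "q \<le> z" using pq by linarith
    then show ?thesis unfolding z q using True by (simp add: divide_le_eq)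
  next
    case False
    moreover have "(3 * of_int z + 1 :: real) \<noteq> 0" using z by (metis power_not_zero neg_equal_0_iff_equal zero_neq_numeral)
    ultimately have neg: "3 * of_int z + 1 < (0::real)" by linarith
    then have "3 * of_int p + 1 > (3 * of_int z + 1 :: real)"
      using assms(3) unfolding z p by (simp add: divide_less_eq)
    then have "p > z" by simp
    then have "q \<ge> z" using pq by linarith
    then show ?thesis unfolding z q using neg by (simp add: divide_le_eq)
  qed
qed

lemma paper_Suc_eq: "paper (Suc k) = {x. \<forall>i\<in>{1, 2, 3}. - 2 \<le> coord i x / (- 2) ^ k}"
proof -
  have "coord i x / (- 2) ^ Suc k \<le> 1 \<longleftrightarrow> - 2 \<le> coord i x / (- 2) ^ k" for i x
  proof -
    have "coord i x / (- 2) ^ Suc k = - (coord i x / (- 2) ^ k) / 2" by simp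
    moreover have "- t / 2 \<le> 1 \<longleftrightarrow> - 2 \<le> t" for t :: real by linarith
    ultimately show ?thesis by metis
  qed
  then show ?thesis unfolding paper_eq by simp
qed

text \<open>Induction over the remaining foldings. Turning over a corner negates both
  \<open>f\<close> and, by \<open>upright_reflect\<close>, the orientation of the cell, so the truth
  of \<open>f = upright\<close> is invariant; a reflected edge keeps its level.\<close>

lemma edge_colour_grid_edge:
  assumes "grid_edge i a b" "a \<in> paper k" "b \<in> paper k"
    "coord i a = (- 2) ^ n * of_int w" "odd w" "n < k"
  shows "edge_colour S k f (closed_segment a b) =
    Some (crease_colour (S (Suc n)) (f = upright (Suc n) (midpoint a b)))"
  using assms
proof (induction k arbitrary: i a b w f)
  case (Suc k)
  define c :: real where "c = (- 2) ^ k"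
  have c0: "c \<noteq> 0" by (simp add: c_def)
  obtain z :: int where z: "c = 3 * of_int z + 1"
    using minus_two_power_mod_3 unfolding c_def by blast
  define M where "M h = {x. coord h x = c \<and> (\<forall>j\<in>{1, 2, 3}. - 2 \<le> coord j x / c)}" for h
  have mid: "paper_midsegments (Suc k) = M ` {1, 2, 3}"
    unfolding paper_midsegments_eq M_def c_def ..
  have i: "i \<in> {1, 2, 3}" using Suc.prems by (simp add: grid_edge_def)
  have ca: "\<forall>j\<in>{1, 2, 3}. - 2 \<le> coord j a / c" and cb: "\<forall>j\<in>{1, 2, 3}. - 2 \<le> coord j b / c"
    using Suc.prems(2,3) unfolding paper_Suc_eq c_def by auto
  have iab: "coord i a = coord i b" using Suc.prems by (simp add: grid_edge_def)
  show ?case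
  proof (cases "n = k")
    case True
    have wa: "coord i a = c * of_int w" using Suc.prems(4) True by (simp add: c_def)
    obtain m :: int where "coord i a = 3 * of_int m + 1"
      using Suc.prems(1) i unfolding grid_edge_def lattice_point_def by blast
    then have "of_int ((3 * z + 1) * w) = (of_int (3 * m + 1) :: real)" using wa z by simp
    then have "(3 * z + 1) * w = 3 * m + 1" by (simp only: of_int_eq_iff)
    then have w3: "w = 3 * (m - z * w) + 1" by (simp add: algebra_simps)
    obtain j l where ind: "indices i j l" using indices_exist i by blast
    note d = indices_distinct[OF ind]
    have sum: "coord i x / c + coord j x / c + coord l x / c = 0" for x
      using coord_sum[OF ind, of x] c0 by (simp add: add_divide_distrib[symmetric])
    have "coord i a / c = of_int w" using wa c0 by simp
    moreover have "- 2 \<le> coord i a / c" "- 2 \<le> coord j a / c" "- 2 \<le> coord l a / c"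
      using ca d by blast+
    ultimately have "- 2 \<le> w" "w \<le> 4" using sum[of a] by linarith+
    \<comment> \<open>Within the bounds, 1 modulo 3 leaves -2, 1 and 4, of which only 1 is odd: the
      edge is on a midsegment.\<close>
    then have w1: "w = 1" using w3 \<open>odd w\<close> by presburger
    have "a \<in> M i" "b \<in> M i" using ca cb wa w1 iab unfolding M_def by auto
    moreover have "convex (M i)"
      using midsegment_eq[OF ind, of k] unfolding M_def c_def by (metis convex_closed_segment)
    ultimately have "closed_segment a b \<subseteq> M i" by (simp add: closed_segment_subset)
    then have "edge_colour S (Suc k) f (closed_segment a b) = Some (crease_colour (S (Suc k)) f)"
      using mid i by auto
    \<comment> \<open>All strip numbers vanish, since the cell is \<open>(-2)^(k+1) T_0\<close>
      itself; hence \<open>f = upright\<close> reduces to \<open>f\<close>.\<close>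
    moreover have "upright (Suc n) (midpoint a b)"
    proof -
      have "\<lceil>cell_coord (Suc n) h (midpoint a b)\<rceil> = 0" if h: "h \<in> {1, 2, 3}" for h
      proof -
        have bound: "- 2 \<le> coord h x / c \<and> coord h x / c \<le> 1" if "x \<in> M i" for x
        proof -
          have q: "\<forall>h\<in>{1, 2, 3}. - 2 \<le> coord h x / c" "coord i x / c = 1"
            using that c0 unfolding M_def by auto
          have "\<forall>h\<in>{1, 2, 3}. - 2 \<le> coord h x / c \<and> coord h x / c \<le> 1"
            using q(1)[unfolded indices_all[OF ind]] sum[of x] q(2)
            unfolding indices_all[OF ind] by auto
          then show ?thesis using h by blast
        qed
        have "coord h (midpoint a b) / (- 2) ^ Suc n = - (coord h a / c + coord h b / c) / 4"
          unfolding coord_midpoint True using c0 by (simp add: c_def field_simps)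
        then have "cell_coord (Suc n) h (midpoint a b) \<le> 0" "- 1 < cell_coord (Suc n) h (midpoint a b)"
          using bound[OF \<open>a \<in> M i\<close>] bound[OF \<open>b \<in> M i\<close>] unfolding cell_coord_def by auto
        then show ?thesis by linarith
      qed
      then show ?thesis unfolding upright_def by simp
    qed
    ultimately show ?thesis using True by simp
  next
    case False
    then have nk: "n < k" using Suc.prems by simp
    \<comment> \<open>On a midsegment of its own direction the edge would have
      \<open>w = (-2)^(k-n)\<close>, which is even as \<open>n < k\<close>; in any other direction
      its ends have different coordinates.\<close>
    have nomid: "\<not> (\<exists>m\<in>paper_midsegments (Suc k). closed_segment a b \<subseteq> m)"
    proof
      assume "\<exists>m\<in>paper_midsegments (Suc k). closed_segment a b \<subseteq> m"
      then obtain h where h: "h \<in> {1, 2, 3}" "closed_segment a b \<subseteq> M h" unfolding mid by blast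
      then have hab: "coord h a = c" "coord h b = c" unfolding M_def by auto
      show False
      proof (cases "h = i")
        case True
        have "c = (- 2) ^ n * (- 2) ^ (k - n)"
          unfolding c_def using nk by (simp flip: power_add)
        then have "real_of_int w = (- 2) ^ (k - n)" using hab(1) True Suc.prems(4) by simp
        then have "real_of_int w = of_int ((- 2) ^ (k - n))" by simp
        then have "w = (- 2) ^ (k - n)" by (simp only: of_int_eq_iff)
        then show False using \<open>odd w\<close> nk by simp
      next
        case False
        then have "\<bar>coord h a - coord h b\<bar> = 3" using Suc.prems(1) h unfolding grid_edge_def by auto
        then show False using hab by simp
      qed
    qed
    show ?thesis
    proof (cases "\<exists>h\<in>{1, 2, 3}. a \<in> corner_region k h \<and> b \<in> corner_region k h")
      case True
      then obtain h where h: "h \<in> {1, 2, 3}" "a \<in> corner_region k h" "b \<in> corner_region k h" by blast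
      obtain j l where ind: "indices h j l" using indices_exist h(1) by blast
      have "convex (corner_region k h)"
        using corner_eq_region[OF ind, of k] unfolding corner_def by (metis convex_convex_hull)
      then have sub: "closed_segment a b \<subseteq> corner_region k h" using h by (simp add: closed_segment_subset)
      let ?a = "reflect h c a" and ?b = "reflect h c b"
      have "paper_fold (Suc k) ` closed_segment a b = reflect h c ` closed_segment a b"
        using sub paper_fold_region[OF h(1)] unfolding c_def by (intro image_cong) auto
      then have fold: "paper_fold (Suc k) ` closed_segment a b = closed_segment ?a ?b"
        by (simp add: reflect_closed_segment)
      have corner: "\<exists>t\<in>paper_corners (Suc k). closed_segment a b \<subseteq> t"
        unfolding paper_corners_eq using h(1) sub by blast
      have in_paper: "reflect h c x \<in> paper k" if x: "x \<in> corner_region k h" for x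
      proof -
        have q: "1 \<le> coord h x / c" "- 2 \<le> coord j x / c" "- 2 \<le> coord l x / c"
          using x indices_distinct[OF ind] unfolding corner_region_def c_def by auto
        have sum: "coord h x / c + coord j x / c + coord l x / c = 0"
          using coord_sum[OF ind, of x] c0 by (simp add: add_divide_distrib[symmetric])
        have "coord h (reflect h c x) / c = 2 - coord h x / c"
          "coord j (reflect h c x) / c = coord j x / c + coord h x / c - 1"
          "coord l (reflect h c x) / c = coord l x / c + coord h x / c - 1"
          using coord_reflect(1)[OF h(1)] coord_reflect(2)[OF h(1)] indices_distinct[OF ind] c0
          by (auto simp: diff_divide_distrib add_divide_distrib)
        then show ?thesis
          using q sum unfolding paper_eq mem_Collect_eq indices_all[OF ind] c_def[symmetric] by auto
      qed
      \<comment> \<open>The level survives because \<open>c\<close> is an even multiple of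
        \<open>(-2)^n\<close>: the new \<open>w'\<close> is \<open>-w\<close> plus an even
        number.\<close>
      have "\<exists>i' w'. grid_edge i' ?a ?b \<and> coord i' ?a = (- 2) ^ n * of_int w' \<and> odd w'"
      proof -
        have ck: "c = (- 2) ^ n * of_int ((- 2) ^ (k - n))"
          unfolding c_def using nk by (simp flip: power_add)
        have ev: "even ((- 2) ^ (k - n) :: int)" using nk by simp
        show ?thesis
        proof (cases "h = i")
          case True
          have "coord i ?a = (- 2) ^ n * of_int (2 * (- 2) ^ (k - n) - w)"
            using coord_reflect(1)[OF i, of c a] True Suc.prems(4) ck by (simp add: algebra_simps)
          moreover have "odd (2 * (- 2) ^ (k - n) - w)" using \<open>odd w\<close> by simp
          moreover have "grid_edge i ?a ?b"
            using grid_edge_reflect_same[OF Suc.prems(1)] True unfolding c_def by simp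
          ultimately show ?thesis by blast
        next
          case False
          then obtain l' where ind': "indices h i l'" using indices_exist2 h(1) i by metis
          have "coord l' ?a = (- 2) ^ n * of_int (- w - (- 2) ^ (k - n))"
            using grid_edge_reflect_other(2)[OF Suc.prems(1) ind', of k] Suc.prems(4) ck
            unfolding c_def[symmetric] by (simp add: algebra_simps)
          moreover have "odd (- w - (- 2) ^ (k - n))" using \<open>odd w\<close> ev by simp
          moreover have "grid_edge l' ?a ?b"
            using grid_edge_reflect_other(1)[OF Suc.prems(1) ind', of k] unfolding c_def .
          ultimately show ?thesis by blast
        qed
      qed
      then obtain i' w' where e': "grid_edge i' ?a ?b" "coord i' ?a = (- 2) ^ n * of_int w'" "odd w'"
        by blast
      have "edge_colour S (Suc k) f (closed_segment a b) = edge_colour S k (\<not> f) (closed_segment ?a ?b)"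
        using nomid corner fold by simp
      also have "\<dots> = Some (crease_colour (S (Suc n)) ((\<not> f) = upright (Suc n) (midpoint ?a ?b)))"
        using Suc.IH[OF e'(1) in_paper[OF h(2)] in_paper[OF h(3)] e'(2,3) nk] .
      also have "upright (Suc n) (midpoint ?a ?b) = (\<not> upright (Suc n) (midpoint a b))"
        unfolding reflect_midpoint[symmetric] c_def
        using upright_reflect[OF h(1) _ grid_edge_midpoint_nonint[OF Suc.prems(1,4,5)]] nk by simp
      finally show ?thesis by (metis (full_types))
    next
      case False
      have notin: "coord h a / c < 1 \<or> coord h b / c < 1" if "h \<in> {1, 2, 3}" for h
        using False that ca cb unfolding corner_region_def c_def by force
      \<comment> \<open>For each direction one end is strictly on the inner side, so the other does
        not lie beyond the fold line; the edge is thus in the central triangle.\<close>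
      have one: "coord h a / c \<le> 1 \<and> coord h b / c \<le> 1" if "h \<in> {1, 2, 3}" for h
        using notin[OF that] grid_edge_one_side[OF Suc.prems(1) that, of k]
          grid_edge_one_side[OF grid_edge_commute[OF Suc.prems(1)] that, of k]
        unfolding c_def by linarith
      then have ap: "a \<in> paper k" and bp: "b \<in> paper k" unfolding paper_eq c_def by auto
      have "convex (paper k)"
        unfolding paper_def T0_def by (intro convex_scaling convex_convex_hull)
      then have sub: "closed_segment a b \<subseteq> paper k" using ap bp by (simp add: closed_segment_subset)
      have "paper_fold (Suc k) ` closed_segment a b = (\<lambda>x. x) ` closed_segment a b"
        using sub unfolding paper_eq by (intro image_cong) (auto intro!: paper_fold_central)
      moreover have "\<not> (\<exists>t\<in>paper_corners (Suc k). closed_segment a b \<subseteq> t)"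
      proof
        assume "\<exists>t\<in>paper_corners (Suc k). closed_segment a b \<subseteq> t"
        then obtain h where "h \<in> {1, 2, 3}" "closed_segment a b \<subseteq> corner_region k h"
          unfolding paper_corners_eq by blast
        then show False using False by (meson ends_in_segment subsetD)
      qed
      ultimately have "edge_colour S (Suc k) f (closed_segment a b) = edge_colour S k f (closed_segment a b)"
        using nomid by simp
      then show ?thesis using Suc.IH[OF Suc.prems(1) ap bp Suc.prems(4,5) nk] by simp
    qed
  qed
qed simp

section \<open>Edges of the grid and their levels\<close>

lemma lattice_pointI:
  assumes "indices i j l" "coord i x = 3 * of_int n + 1" "coord j x = 3 * of_int m + 1"
  shows "lattice_point x"
proof -
  have "coord l x = 3 * of_int (- n - m - 1) + 1" using coord_sum[OF assms(1), of x] assms by simp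
  then show ?thesis unfolding lattice_point_def indices_all[OF assms(1)] using assms by blast
qed

text \<open>Cardinality: a segment contained in no single line would meet each of the countably many
  lines in at most one point, but it is uncountable.\<close>

lemma segment_in_grid_line:
  assumes "closed_segment a b \<subseteq> grid" "a \<noteq> b"
  shows "\<exists>i\<in>{1, 2, 3}. \<exists>n::int. coord i a = 3 * of_int n + 1 \<and> coord i b = 3 * of_int n + 1"
proof (rule ccontr)
  assume neg: "\<not> ?thesis"
  have "x = y" if i: "i \<in> {1, 2, 3}" and x: "x \<in> grid_line i n \<inter> closed_segment a b"
    and y: "y \<in> grid_line i n \<inter> closed_segment a b" for i n x y
  proof (rule ccontr)
    assume "x \<noteq> y"
    have "x \<in> closed_segment a b" "y \<in> closed_segment a b" using x y by auto
    then obtain s t where s: "x = (1 - s) *\<^sub>R a + s *\<^sub>R b" and t: "y = (1 - t) *\<^sub>R a + t *\<^sub>R b"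
      unfolding in_segment by blast
    have cx: "coord i x = 3 * of_int n + 1" and cy: "coord i y = 3 * of_int n + 1"
      using x y unfolding grid_line_def coord_def by auto
    have ex: "coord i x = coord i a + s * (coord i b - coord i a)"
      "coord i y = coord i a + t * (coord i b - coord i a)"
      unfolding s t by (simp_all add: coord_linear algebra_simps)
    have "s \<noteq> t" using \<open>x \<noteq> y\<close> s t by blast
    moreover have "(s - t) * (coord i b - coord i a) = 0"
      unfolding left_diff_distrib using cx cy ex by linarith
    ultimately have "coord i b = coord i a" by simp
    then have "coord i a = 3 * of_int n + 1 \<and> coord i b = 3 * of_int n + 1" using ex cx by simp
    then show False using neg i by blast
  qed
  note unique = this
  have "countable (grid_line i n \<inter> closed_segment a b)" if i: "i \<in> {1, 2, 3}" for i n
  proof (cases "grid_line i n \<inter> closed_segment a b = {}")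
    case False
    then obtain x where "x \<in> grid_line i n \<inter> closed_segment a b" by blast
    then have "grid_line i n \<inter> closed_segment a b \<subseteq> {x}" using unique[OF i] by blast
    then show ?thesis by (rule countable_subset) simp
  qed simp
  then have "countable (\<Union>i\<in>{1, 2, 3}. \<Union>n. grid_line i n \<inter> closed_segment a b)"
    by (intro countable_UN) auto
  moreover have "closed_segment a b = (\<Union>i\<in>{1, 2, 3}. \<Union>n. grid_line i n \<inter> closed_segment a b)"
    using assms(1) unfolding grid_def by blast
  ultimately show False using uncountable_closed_segment[OF assms(2)] by metis
qed

lemma unit_distance_on_line:
  assumes "indices i j l" "coord i a = coord i b" "dist a b = 1"
  shows "\<bar>coord j a - coord j b\<bar> = 3"
proof -
  let ?d = "a - b"
  have "coord i ?d = 0" "coord l ?d = - coord j ?d"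
    using assms(2) coord_sum[OF assms(1), of ?d] by (simp_all add: coord_linear)
  then have "2 * (coord j ?d)\<^sup>2 = 18"
    using sum_coord_squares_indices[OF assms(1), of ?d] assms(3) by (simp add: dist_norm)
  then have "\<bar>coord j ?d\<bar>\<^sup>2 = 3\<^sup>2" by simp
  then have "\<bar>coord j ?d\<bar> = 3" by (rule power2_eq_imp_eq) auto
  then show ?thesis by (simp add: coord_linear)
qed

lemma unit_triangle_rotate: "unit_triangle a b c \<Longrightarrow> unit_triangle b c a"
  unfolding unit_triangle_def by auto

text \<open>The two sides at \<open>b\<close> lie on grid lines of different directions, and two
  coordinates that are 1 modulo 3 suffice.\<close>

lemma unit_triangle_lattice_point:
  assumes "unit_triangle a b c" shows "lattice_point b"
proof -
  have d: "dist a b = 1" "dist b c = 1" "dist c a = 1" using assms unfolding unit_triangle_def by auto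
  then have "a \<noteq> b" "b \<noteq> c" by auto
  then obtain i n i' n' where i: "i \<in> {1, 2, 3}" "coord i a = 3 * of_int n + 1" "coord i b = 3 * of_int n + 1"
    and i': "i' \<in> {1, 2, 3}" "coord i' b = 3 * of_int n' + 1" "coord i' c = 3 * of_int n' + 1"
    using segment_in_grid_line[of a b] segment_in_grid_line[of b c] assms
    unfolding unit_triangle_def by metis
  have "i \<noteq> i'"
  proof
    assume "i = i'"
    then have eq: "coord i a = coord i b" "coord i b = coord i c" "coord i c = coord i a" using i i' by auto
    obtain j l where ind: "indices i j l" using indices_exist i by blast
    \<comment> \<open>The three differences around the triangle sum to zero, which is impossible if
      each has absolute value 3.\<close>
    show False
      using unit_distance_on_line[OF ind eq(1) d(1)] unit_distance_on_line[OF ind eq(2) d(2)]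
        unit_distance_on_line[OF ind eq(3) d(3)] by linarith
  qed
  then obtain l where "indices i i' l" using indices_exist2 i i' by metis
  then show ?thesis using lattice_pointI i i' by blast
qed

lemma unit_edge_imp_grid_edge:
  assumes "unit_edge (closed_segment a b)"
  shows "\<exists>i. grid_edge i a b"
proof -
  obtain a' b' c where t: "unit_triangle a' b' c" and eq: "closed_segment a b = closed_segment a' b'"
    using assms unfolding unit_edge_def by blast
  have lat: "lattice_point a'" "lattice_point b'"
    using unit_triangle_lattice_point t unit_triangle_rotate by blast+
  have d: "dist a' b' = 1" "closed_segment a' b' \<subseteq> grid" using t unfolding unit_triangle_def by auto
  then have "a' \<noteq> b'" by auto
  then obtain i where i: "i \<in> {1, 2, 3}" "coord i a' = coord i b'"
    using segment_in_grid_line d by metis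
  have "\<bar>coord j a' - coord j b'\<bar> = 3" if j: "j \<in> {1, 2, 3} - {i}" for j
  proof -
    have "j \<in> {1, 2, 3}" "i \<noteq> j" using j by auto
    then obtain l where "indices i j l" using indices_exist2 i(1) by metis
    then show ?thesis using unit_distance_on_line i d by blast
  qed
  then have "grid_edge i a' b'" unfolding grid_edge_def using i lat by blast
  moreover have "a = a' \<and> b = b' \<or> a = b' \<and> b = a'"
    using eq by (auto simp: doubleton_eq_iff)
  ultimately show ?thesis using grid_edge_commute by blast
qed

lemma unit_edge_diameter:
  assumes "unit_edge e" "x \<in> e" "y \<in> e"
  shows "dist x y \<le> 1"
proof -
  obtain a b where e: "e = closed_segment a b" "dist a b = 1"
    using assms unfolding unit_edge_def unit_triangle_def by blast
  obtain s t where s: "0 \<le> s" "s \<le> 1" "x = (1 - s) *\<^sub>R a + s *\<^sub>R b"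
    and t: "0 \<le> t" "t \<le> 1" "y = (1 - t) *\<^sub>R a + t *\<^sub>R b"
    using assms(2,3) unfolding e in_segment by blast
  have "x - y = (t - s) *\<^sub>R (a - b)" unfolding s t by (simp add: algebra_simps)
  then have "dist x y = \<bar>t - s\<bar>" using e(2) by (simp add: dist_norm)
  then show ?thesis using s t by linarith
qed

section \<open>Translations of the grid\<close>

definition grid_vector :: "complex \<Rightarrow> bool" where
  "grid_vector v \<longleftrightarrow> (\<forall>i\<in>{1, 2, 3}. \<exists>n::int. coord i v = 3 * of_int n)"

lemma grid_translate:
  assumes "grid_vector v" "x \<in> grid"
  shows "v + x \<in> grid"
proof -
  obtain i n where i: "i \<in> {1, 2, 3}" "coord i x = 3 * of_int n + 1"
    using assms(2) unfolding grid_def grid_line_def coord_def by blast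
  obtain m :: int where "coord i v = 3 * of_int m" using assms i unfolding grid_vector_def by blast
  then have "coord i (v + x) = 3 * of_int (m + n) + 1" using i by (simp add: coord_linear)
  then show ?thesis using i unfolding grid_def grid_line_def coord_def by blast
qed

text \<open>Translating the whole triangle carries along the third vertex that
  \<open>unit_edge\<close> asks for.\<close>

lemma unit_edge_translate:
  assumes "grid_vector v" "unit_edge e"
  shows "unit_edge ((+) v ` e)"
proof -
  obtain a b c where t: "unit_triangle a b c" and e: "e = closed_segment a b"
    using assms unfolding unit_edge_def by blast
  have "closed_segment (v + p) (v + q) \<subseteq> grid" if "closed_segment p q \<subseteq> grid" for p q
    unfolding closed_segment_translation using that grid_translate[OF assms(1)] by blast
  then have "unit_triangle (v + a) (v + b) (v + c)"
    using t unfolding unit_triangle_def by simp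
  moreover have "(+) v ` e = closed_segment (v + a) (v + b)"
    unfolding e closed_segment_translation ..
  ultimately show ?thesis unfolding unit_edge_def by blast
qed

lemma grid_edge_grid_vector:
  assumes "grid_edge i a b"
  shows "grid_vector (of_int t *\<^sub>R (b - a))"
  unfolding grid_vector_def
proof
  fix j :: nat assume "j \<in> {1, 2, 3}"
  then obtain p q :: int where "coord j a = 3 * of_int p + 1" "coord j b = 3 * of_int q + 1"
    using assms unfolding grid_edge_def lattice_point_def by blast
  then have "coord j (of_int t *\<^sub>R (b - a)) = 3 * of_int (t * (q - p))"
    by (simp add: coord_linear algebra_simps)
  then show "\<exists>n::int. coord j (of_int t *\<^sub>R (b - a)) = 3 * of_int n" by blast
qed

section \<open>Levels of grid lines\<close>

lemma odd_part_exists: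
  assumes "(m::int) \<noteq> 0" shows "\<exists>n w. odd w \<and> m = (- 2) ^ n * w"
  using assms
proof (induction "nat \<bar>m\<bar>" arbitrary: m rule: less_induct)
  case less
  show ?case
  proof (cases "even m")
    case True
    then obtain q where q: "m = 2 * q" by blast
    \<comment> \<open>The base is -2, so the recursion passes to \<open>- q\<close>.\<close>
    then have "nat \<bar>- q\<bar> < nat \<bar>m\<bar>" "- q \<noteq> 0" using less.prems by auto
    then obtain n w where w: "odd w" "- q = (- 2) ^ n * w" using less.hyps by blast
    have "m = - 2 * - q" using q by simp
    then have "m = (- 2) ^ Suc n * w" unfolding w(2) power_Suc mult.assoc .
    then show ?thesis using w(1) by blast
  next
    case False
    then show ?thesis by (intro exI[of _ 0] exI[of _ m]) simp
  qed
qed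

text \<open>\<open>has_level n i a\<close>: the line \<open>coord i = coord i a\<close> is a fold line of the folding with index \<open>Suc n\<close>.\<close>

definition has_level :: "nat \<Rightarrow> nat \<Rightarrow> complex \<Rightarrow> bool" where
  "has_level n i a \<longleftrightarrow> (\<exists>w. odd w \<and> coord i a = (- 2) ^ n * of_int w)"

lemma has_level_exists:
  assumes "grid_edge i a b" shows "\<exists>n. has_level n i a"
proof -
  obtain m :: int where m: "coord i a = 3 * of_int m + 1"
    using assms unfolding grid_edge_def lattice_point_def by blast
  \<comment> \<open>No grid line passes through the origin, so the power of 2 in its coordinate is
    finite.\<close>
  have "3 * m + 1 \<noteq> 0" by presburger
  then obtain n w where w: "odd w" "3 * m + 1 = (- 2) ^ n * w" using odd_part_exists by blast
  have "coord i a = of_int (3 * m + 1)" using m by simp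
  then have "coord i a = (- 2) ^ n * of_int w" unfolding w(2) by simp
  then show ?thesis unfolding has_level_def using w(1) by blast
qed

section \<open>Edges inside the growing triangles\<close>

lemma interior_paper_strict:
  assumes "x \<in> interior (paper k)" "i \<in> {1, 2, 3}"
  shows "coord i x / (- 2) ^ k < 1"
proof -
  let ?v = "(1 / (- 2) ^ k) *\<^sub>R xi i"
  have eq: "?v \<bullet> x = coord i x / (- 2) ^ k" for x
    by (simp add: coord_def inner_commute)
  have "coord i (T0_vertex i) = - 2" using coord_T0_vertex[OF assms(2) assms(2)] by simp
  then have "xi i \<noteq> 0" unfolding coord_def by auto
  then have v: "?v \<noteq> 0" by simp
  have "paper k \<subseteq> {x. ?v \<bullet> x \<le> 1}" unfolding paper_eq eq using assms(2) by blast
  then have "x \<in> interior {x. ?v \<bullet> x \<le> 1}" using assms(1) interior_mono by blast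
  then show ?thesis using interior_halfspace_le[OF v] eq by auto
qed

text \<open>The triangles contain arbitrarily large balls about \<open>O\<close>, because each
  coordinate is at most 5 times the norm.\<close>

lemma bounded_in_interior_paper:
  assumes "bounded e" shows "\<exists>k. e \<subseteq> interior (paper k)"
proof -
  obtain B where B: "\<And>x. x \<in> e \<Longrightarrow> norm x \<le> B" using assms unfolding bounded_iff by blast
  obtain k where k: "5 * (B + 1) < 2 ^ k" using real_arch_pow[of 2 "5 * (B + 1)"] by auto
  have "x \<in> paper k" if "norm x < B + 1" for x
  proof -
    have "coord i x / (- 2) ^ k \<le> 1" if "i \<in> {1, 2, 3}" for i
    proof -
      have "5 * norm x < 5 * (B + 1)" using \<open>norm x < B + 1\<close> by simp
      then have "\<bar>coord i x\<bar> < 2 ^ k"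
        using abs_coord_le[OF that, of x] k by (meson le_less_trans less_trans)
      then have "\<bar>coord i x / (- 2) ^ k\<bar> \<le> 1" by (simp add: power_abs)
      then show ?thesis by linarith
    qed
    then show ?thesis unfolding paper_eq by blast
  qed
  then have "ball 0 (B + 1) \<subseteq> paper k" by auto
  then have "ball 0 (B + 1) \<subseteq> interior (paper k)" by (simp add: interior_maximal)
  moreover have "e \<subseteq> ball 0 (B + 1)" using B by force
  ultimately show ?thesis by blast
qed

text \<open>A line of level at least \<open>k\<close> is \<open>coord i = (-2)^k * t\<close> with
  \<open>t\<close> equal to 1 modulo 3, while an interior point of \<open>(-2)^k T_0\<close> needs
  \<open>-2 < t < 1\<close>. So an interior edge is coloured by one of the first \<open>k\<close>
  foldings.\<close>

lemma level_less_of_interior: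
  assumes "grid_edge i a b" "has_level n i a" "a \<in> interior (paper k)"
  shows "n < k"
proof (rule ccontr)
  assume "\<not> n < k"
  then have nk: "k \<le> n" by simp
  have i: "i \<in> {1, 2, 3}" using assms by (simp add: grid_edge_def)
  obtain w where w: "coord i a = (- 2) ^ n * of_int w" using assms(2) unfolding has_level_def by blast
  define t where "t = (- 2) ^ (n - k) * w"
  have "(- 2) ^ n = ((- 2) ^ k * (- 2) ^ (n - k) :: real)" using nk by (simp flip: power_add)
  then have t: "coord i a = (- 2) ^ k * of_int t" unfolding w t_def by simp
  obtain z :: int where z: "(- 2) ^ k = (3 * of_int z + 1 :: real)"
    using minus_two_power_mod_3 by blast
  obtain m :: int where "coord i a = 3 * of_int m + 1"
    using assms(1) i unfolding grid_edge_def lattice_point_def by blast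
  then have "of_int ((3 * z + 1) * t) = (of_int (3 * m + 1) :: real)" using t z by simp
  then have "(3 * z + 1) * t = 3 * m + 1" by (simp only: of_int_eq_iff)
  then have t3: "t = 3 * (m - z * t) + 1" by (simp add: algebra_simps)
  obtain j l where ind: "indices i j l" using indices_exist i by blast
  note d = indices_distinct[OF ind]
  have "coord i a / (- 2) ^ k + coord j a / (- 2) ^ k + coord l a / (- 2) ^ k = 0"
    using coord_sum[OF ind, of a] by (simp add: add_divide_distrib[symmetric])
  moreover have "coord i a / (- 2) ^ k = of_int t" using t by simp
  moreover have "coord i a / (- 2) ^ k < 1" "coord j a / (- 2) ^ k < 1" "coord l a / (- 2) ^ k < 1"
    using interior_paper_strict[OF assms(3)] d by blast+
  ultimately have "- 2 < t" "t < 1" by linarith+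
  then show False using t3 by presburger
qed

text \<open>The colour formula does not mention \<open>k\<close>, so all triangles with the edge in
  their interior agree, and some such triangle exists. Every edge thus gets exactly one
  colour.\<close>

lemma folding_pattern_iff:
  assumes u: "unit_edge (closed_segment a b)" and e: "grid_edge i a b" and l: "has_level n i a"
  shows "(closed_segment a b, c) \<in> folding_pattern S \<longleftrightarrow>
    c = crease_colour (S (Suc n)) (upright (Suc n) (midpoint a b))"
proof -
  have col: "edge_colour S k True (closed_segment a b) =
      Some (crease_colour (S (Suc n)) (upright (Suc n) (midpoint a b)))"
    and sub: "closed_segment a b \<subseteq> paper k"
    if k: "closed_segment a b \<subseteq> interior (paper k)" for k
  proof -
    show "closed_segment a b \<subseteq> paper k" using k interior_subset by blast
    then have ab: "a \<in> paper k" "b \<in> paper k" by auto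
    have "a \<in> interior (paper k)" using k by auto
    then have "n < k" using level_less_of_interior e l by blast
    then show "edge_colour S k True (closed_segment a b) =
      Some (crease_colour (S (Suc n)) (upright (Suc n) (midpoint a b)))"
      using edge_colour_grid_edge[OF e ab, where f = True] l unfolding has_level_def by auto
  qed
  obtain k where "closed_segment a b \<subseteq> interior (paper k)"
    using bounded_in_interior_paper bounded_closed_segment by blast
  then show ?thesis
    unfolding folding_pattern_def finite_folding_pattern_def mem_Collect_eq case_prod_conv
    using u col sub by (metis option.inject)
qed

section \<open>Colours along a grid line\<close>

lemma ceiling_sum_parity:
  fixes p q r :: real and z :: int
  assumes "p + q + r = - 1" "p = - of_int z - 1 / 2" "r \<notin> \<int>"
  shows "\<lceil>p\<rceil> + (\<lceil>q\<rceil> + \<lceil>r\<rceil>) = 0 \<longleftrightarrow> even \<lceil>2 * q\<rceil>"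
proof -
  define A where "A = \<lceil>q\<rceil>"
  have p: "\<lceil>p\<rceil> = - z" using assms(2) by linarith
  have r: "r = of_int z - 1 / 2 - q" using assms by simp
  have A: "of_int A - 1 < q" "q \<le> of_int A" unfolding A_def by linarith+
  \<comment> \<open>The sum of ceilings tells which half of its unit interval contains
    \<open>q\<close>. At the exact middle \<open>r\<close> would be an integer.\<close>
  consider "q > of_int A - 1 / 2" | "q = of_int A - 1 / 2" | "q < of_int A - 1 / 2" by linarith
  then show ?thesis
  proof cases
    case 1
    then have "\<lceil>2 * q\<rceil> = 2 * A" "\<lceil>r\<rceil> = z - A" using A r by linarith+
    then show ?thesis using p unfolding A_def by simp
  next
    case 2
    then have "r = of_int (z - A)" using r by simp
    then show ?thesis using assms(3) by auto
  next
    case 3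
    then have "\<lceil>2 * q\<rceil> = 2 * A - 1" "\<lceil>r\<rceil> = z - A + 1" using A r by linarith+
    then show ?thesis using p unfolding A_def by simp
  qed
qed

text \<open>A line of level \<open>n\<close> runs midway between two lines of the
  \<open>(-2)^(n+1)\<close>-scaled grid, through upright and inverted cells in turn; each is crossed
  along a midsegment, half a cell side. Hence the factor 2 before the cell coordinate.\<close>

lemma upright_iff_even:
  assumes e: "grid_edge i a b" and l: "has_level n i a" and ind: "indices i j l"
  shows "upright (Suc n) (midpoint a b) \<longleftrightarrow> even \<lceil>2 * cell_coord (Suc n) j (midpoint a b)\<rceil>"
proof -
  obtain w where w: "odd w" "coord i a = (- 2) ^ n * of_int w" using l unfolding has_level_def by blast
  obtain z :: int where z: "(- 2) ^ n = (3 * of_int z + 1 :: real)"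
    using minus_two_power_mod_3 by blast
  obtain m :: int where "coord i a = 3 * of_int m + 1"
    using e unfolding grid_edge_def lattice_point_def by blast
  then have "of_int ((3 * z + 1) * w) = (of_int (3 * m + 1) :: real)" using w z by simp
  then have "(3 * z + 1) * w = 3 * m + 1" by (simp only: of_int_eq_iff)
  then have w3: "w = 3 * (m - z * w) + 1" by (simp add: algebra_simps)
  \<comment> \<open>\<open>w\<close> is odd and 1 modulo 3, so it is 1 modulo 6.\<close>
  then have "even (m - z * w)" using \<open>odd w\<close> by presburger
  then obtain y where "m - z * w = 2 * y" by blast
  then have y: "w = 6 * y + 1" using w3 by simp
  have "coord i (midpoint a b) = (- 2) ^ n * of_int w"
    using e w by (simp add: coord_midpoint grid_edge_def)
  then have "coord i (midpoint a b) / (- 2) ^ Suc n = - (of_int w / 2)" by simp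
  then have "cell_coord (Suc n) i (midpoint a b) = - of_int y - 1 / 2"
    unfolding cell_coord_def y by simp
  moreover have "cell_coord (Suc n) l (midpoint a b) \<notin> \<int>"
    using grid_edge_midpoint_nonint[OF e w(2,1)] indices_distinct[OF ind] by blast
  ultimately show ?thesis
    unfolding upright_def indices_sum[OF ind]
    using ceiling_sum_parity[OF cell_coord_sum[OF ind]] by blast
qed

text \<open>The parameter \<open>q\<close> is twice a cell coordinate, in which a block of \<open>2 ^ n\<close> unit edges has length 1.\<close>

lemma line_colours:
  assumes u: "unit_edge (closed_segment a b)" and e: "grid_edge i a b" and l: "has_level n i a"
  shows "\<exists>q \<delta> :: real. (p = n \<longrightarrow> \<bar>\<delta>\<bar> = 1) \<and> (p < n \<longrightarrow> \<bar>\<delta>\<bar> \<le> 1 / 2) \<and>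
    (\<forall>S c t. ((+) ((real t * 2 ^ p) *\<^sub>R (b - a)) ` closed_segment a b, c) \<in> folding_pattern S \<longleftrightarrow>
      c = crease_colour (S (Suc n)) (even \<lceil>q + real t * \<delta>\<rceil>))"
proof -
  have i: "i \<in> {1, 2, 3}" "coord i a = coord i b" using e by (simp_all add: grid_edge_def)
  obtain j k where ind: "indices i j k" using indices_exist i by blast
  define s where "s = (coord j b - coord j a) / 3"
  have "j \<in> {1, 2, 3} - {i}" using indices_distinct(1,5)[OF ind] by simp
  moreover have "\<forall>j\<in>{1, 2, 3} - {i}. \<bar>coord j a - coord j b\<bar> = 3" 
    using e unfolding grid_edge_def by (elim conjE)
  ultimately have "\<bar>coord j a - coord j b\<bar> = 3" by (rule bspec[rotated])
  then have s: "\<bar>s\<bar> = 1" unfolding s_def by (simp add: abs_minus_commute)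
  define q where "q = 2 * cell_coord (Suc n) j (midpoint a b)"
  \<comment> \<open>Moving by \<open>2 ^ p\<close> edges changes \<open>coord j\<close> by
    \<open>3 * 2 ^ p * s\<close>, where the sign \<open>s\<close> records the direction of travel: a
    whole block if \<open>p = n\<close>, at most half a block if \<open>p < n\<close>.\<close>
  define \<delta> where "\<delta> = 2 * (2 ^ p * s / (- 2) ^ Suc n)"
  have d: "\<bar>\<delta>\<bar> = 2 ^ p / 2 ^ n"
    unfolding \<delta>_def using s by (simp add: abs_mult power_abs)
  have "p = n \<longrightarrow> \<bar>\<delta>\<bar> = 1" unfolding d by simp
  moreover have "p < n \<longrightarrow> \<bar>\<delta>\<bar> \<le> 1 / 2"
  proof
    assume "p < n"
    then have "(2::real) ^ Suc p \<le> 2 ^ n" by (intro power_increasing) auto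
    then show "\<bar>\<delta>\<bar> \<le> 1 / 2" unfolding d by (simp add: field_simps)
  qed
  moreover have "((+) ((real t * 2 ^ p) *\<^sub>R (b - a)) ` closed_segment a b, c) \<in> folding_pattern S \<longleftrightarrow>
      c = crease_colour (S (Suc n)) (even \<lceil>q + real t * \<delta>\<rceil>)" for S c t
  proof -
    define T where "T = real t * 2 ^ p"
    let ?v = "T *\<^sub>R (b - a)"
    have "T = of_int (int t * 2 ^ p)" by (simp add: T_def)
    then have v: "grid_vector ?v" using grid_edge_grid_vector[OF e] by metis
    have seg: "(+) ?v ` closed_segment a b = closed_segment (?v + a) (?v + b)"
      by (rule closed_segment_translation[symmetric])
    have u': "unit_edge (closed_segment (?v + a) (?v + b))"
      using unit_edge_translate[OF v u] seg by simp
    have lat: "lattice_point (?v + x)" if x: "lattice_point x" for x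
      unfolding lattice_point_def
    proof
      fix h :: nat assume h: "h \<in> {1, 2, 3}"
      obtain m1 m2 :: int where "coord h ?v = 3 * of_int m1" "coord h x = 3 * of_int m2 + 1"
        using v x h unfolding grid_vector_def lattice_point_def by blast
      then have "coord h (?v + x) = 3 * of_int (m1 + m2) + 1" by (simp add: coord_linear)
      then show "\<exists>n::int. coord h (?v + x) = 3 * of_int n + 1" by blast
    qed
    have e': "grid_edge i (?v + a) (?v + b)"
      using e lat unfolding grid_edge_def by (simp add: coord_linear(1))
    have "coord i ?v = 0" using i by (simp add: coord_linear)
    then have l': "has_level n i (?v + a)" using l unfolding has_level_def by (simp add: coord_linear(1))
    have "coord j ?v = 3 * (T * s)" by (simp add: coord_linear s_def)
    then have "coord j (midpoint (?v + a) (?v + b)) = coord j (midpoint a b) + 3 * (T * s)"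
      by (simp only: coord_midpoint coord_linear(1)) (simp add: field_simps)
    then have "coord j (midpoint (?v + a) (?v + b)) / (- 2) ^ Suc n
        = coord j (midpoint a b) / (- 2) ^ Suc n + 3 * (T * s / (- 2) ^ Suc n)"
      by (simp add: add_divide_distrib)
    moreover have "x = y + 3 * g \<Longrightarrow> 2 * ((x - 1) / 3) = 2 * ((y - 1) / 3) + 2 * g" for x y g :: real
      by (simp add: field_simps)
    ultimately have "2 * cell_coord (Suc n) j (midpoint (?v + a) (?v + b)) = q + 2 * (T * s / (- 2) ^ Suc n)"
      unfolding q_def cell_coord_def by blast
    also have "2 * (T * s / (- 2) ^ Suc n) = real t * \<delta>" by (simp add: \<delta>_def T_def)
    finally have "upright (Suc n) (midpoint (?v + a) (?v + b)) \<longleftrightarrow> even \<lceil>q + real t * \<delta>\<rceil>"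
      using upright_iff_even[OF e' l' ind] by simp
    then show ?thesis
      using folding_pattern_iff[OF u' e' l'] seg unfolding T_def by simp
  qed
  ultimately show ?thesis by blast
qed

section \<open>Telling levels apart\<close>

lemma crease_colour_inject: "crease_colour s x = crease_colour s y \<longleftrightarrow> x = y"
  unfolding crease_colour_def by auto

text \<open>Both steps go the same way and together cover at most 1, so the ceiling cannot change at
  each of them.\<close>

lemma slow_steps_repeat_ceiling:
  fixes q \<delta> :: real
  assumes "\<bar>\<delta>\<bar> \<le> 1 / 2"
  shows "\<lceil>q\<rceil> = \<lceil>q + \<delta>\<rceil> \<or> \<lceil>q + \<delta>\<rceil> = \<lceil>q + 2 * \<delta>\<rceil>"
  using assms by linarith

lemma unit_steps_alternate:
  fixes q \<delta> :: real
  assumes "\<bar>\<delta>\<bar> = 1"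
  shows "even \<lceil>q\<rceil> \<longleftrightarrow> odd \<lceil>q + \<delta>\<rceil>" "even \<lceil>q + \<delta>\<rceil> \<longleftrightarrow> odd \<lceil>q + 2 * \<delta>\<rceil>"
proof -
  obtain s :: int where s: "\<delta> = of_int s" "odd s"
  proof (cases "\<delta> = 1")
    case True
    then show ?thesis using that[of 1] by simp
  next
    case False
    then have "\<delta> = - 1" using assms by linarith
    then show ?thesis using that[of "- 1"] by simp
  qed
  have "q + 2 * \<delta> = q + of_int (2 * s)" using s by simp
  then have "\<lceil>q + \<delta>\<rceil> = \<lceil>q\<rceil> + s" "\<lceil>q + 2 * \<delta>\<rceil> = \<lceil>q\<rceil> + 2 * s"
    using s(1) ceiling_add_of_int by metis+
  then show "even \<lceil>q\<rceil> \<longleftrightarrow> odd \<lceil>q + \<delta>\<rceil>" "even \<lceil>q + \<delta>\<rceil> \<longleftrightarrow> odd \<lceil>q + 2 * \<delta>\<rceil>" using s(2) by auto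
qed

lemma level_distinguished:
  assumes "unit_edge (closed_segment a b)" "grid_edge i a b" "has_level n i a"
    and "unit_edge (closed_segment a' b')" "grid_edge i' a' b'" "has_level n' i' a'"
    and less: "n < n'"
    and same: "\<And>t c. t \<le> 2 \<Longrightarrow>
      ((+) ((real t * 2 ^ n) *\<^sub>R (b - a)) ` closed_segment a b, c) \<in> folding_pattern S \<longleftrightarrow>
      ((+) ((real t * 2 ^ n) *\<^sub>R (b' - a')) ` closed_segment a' b', c) \<in> folding_pattern S"
  shows False
proof -
  obtain q \<delta> :: real where d: "\<bar>\<delta>\<bar> = 1"
    and c: "\<And>S c t. ((+) ((real t * 2 ^ n) *\<^sub>R (b - a)) ` closed_segment a b, c) \<in> folding_pattern S \<longleftrightarrow>
      c = crease_colour (S (Suc n)) (even \<lceil>q + real t * \<delta>\<rceil>)"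
    using line_colours[OF assms(1-3), of n] by auto
  obtain q' \<delta>' :: real where d': "\<bar>\<delta>'\<bar> \<le> 1 / 2"
    and c': "\<And>S c t. ((+) ((real t * 2 ^ n) *\<^sub>R (b' - a')) ` closed_segment a' b', c) \<in> folding_pattern S \<longleftrightarrow>
      c = crease_colour (S (Suc n')) (even \<lceil>q' + real t * \<delta>'\<rceil>)"
    using line_colours[OF assms(4-6), of n] less by auto
  have eq: "crease_colour (S (Suc n)) (even \<lceil>q + real t * \<delta>\<rceil>)
      = crease_colour (S (Suc n')) (even \<lceil>q' + real t * \<delta>'\<rceil>)" if "t \<le> 2" for t
    using same[OF that] unfolding c c' by metis
  have eqs: "crease_colour (S (Suc n)) (even \<lceil>q\<rceil>) = crease_colour (S (Suc n')) (even \<lceil>q'\<rceil>)"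
    "crease_colour (S (Suc n)) (even \<lceil>q + \<delta>\<rceil>) = crease_colour (S (Suc n')) (even \<lceil>q' + \<delta>'\<rceil>)"
    "crease_colour (S (Suc n)) (even \<lceil>q + 2 * \<delta>\<rceil>) = crease_colour (S (Suc n')) (even \<lceil>q' + 2 * \<delta>'\<rceil>)"
    using eq[of 0] eq[of 1] eq[of 2] by simp_all
  \<comment> \<open>\<open>crease_colour\<close> is injective in the facing, so alternation and
    repetition of parities show in the colours whatever the foldings are.\<close>
  show False
    using slow_steps_repeat_ceiling[OF d', of q'] unit_steps_alternate[OF d, of q] eqs
    by (metis crease_colour_inject)
qed

section \<open>Local derivability\<close>

lemma restricted_translate_unit_edge:
  assumes tr: "translate_pattern (y - x) (restrict_pattern (folding_pattern S) (ball x r))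
      = restrict_pattern (folding_pattern S) (ball y r)"
    and e: "(e, c) \<in> folding_pattern S" "e \<subseteq> cball x \<rho>" "\<rho> + 1 < r" "e \<noteq> {}"
  shows "((+) (y - x) ` e, c) \<in> folding_pattern S"
proof -
  have "e \<subseteq> ball x r" using e(2,3) by auto
  then have "e \<inter> ball x r = e" by blast
  then have "(e, c) \<in> restrict_pattern (folding_pattern S) (ball x r)"
    unfolding restrict_pattern_def using e(1,4) by force
  then have "((+) (y - x) ` e, c) \<in> restrict_pattern (folding_pattern S) (ball y r)"
    unfolding tr[symmetric] translate_pattern_def by force
  then obtain e' where e': "(e', c) \<in> folding_pattern S" "(+) (y - x) ` e = e' \<inter> ball y r"
    unfolding restrict_pattern_def by blast
  obtain z where z: "z \<in> e" using e(4) by blast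
  let ?z = "y - x + z"
  have z': "?z \<in> e'" using z e'(2) by blast
  have "dist y ?z = dist x z" by (simp add: dist_norm norm_minus_commute)
  then have zd: "dist y ?z \<le> \<rho>" using z e(2) by auto
  have u: "unit_edge e'" using e'(1) unfolding folding_pattern_def finite_folding_pattern_def by blast
  \<comment> \<open>A priori only the part of \<open>e'\<close> inside the ball is known. The margin
    of 1, the largest distance within an edge, keeps all of \<open>e'\<close> inside.\<close>
  have "e' \<subseteq> ball y r"
  proof
    fix p assume "p \<in> e'"
    then have "dist ?z p \<le> 1" using unit_edge_diameter[OF u z'] by blast
    then have "dist y p \<le> \<rho> + 1" using zd dist_triangle[of y p ?z] by linarith
    then show "p \<in> ball y r" using e(3) by simp
  qed
  then have "(+) (y - x) ` e = e'" using e'(2) by blast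
  then show ?thesis using e'(1) by simp
qed

text \<open>The ball shows the test edges for all levels up to \<open>N\<close>. So the translated
  edge has the same level, or both levels exceed \<open>N\<close>, where \<open>S\<close> and
  \<open>R\<close> agree.\<close>

lemma folding_pattern_transfer:
  assumes tail: "\<And>i. N < i \<Longrightarrow> S i = R i"
    and tr: "translate_pattern (y - x) (restrict_pattern (folding_pattern S) (ball x (2 * 2 ^ N + 3)))
      = restrict_pattern (folding_pattern S) (ball y (2 * 2 ^ N + 3))"
    and e: "(e, c) \<in> folding_pattern R" "x \<in> e"
  shows "((+) (y - x) ` e, c) \<in> folding_pattern R"
proof -
  let ?v = "y - x"
  have "unit_edge e" using e unfolding folding_pattern_def finite_folding_pattern_def by blast
  then obtain a b where ab: "e = closed_segment a b" "dist a b = 1"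
    unfolding unit_edge_def unit_triangle_def by blast
  have u: "unit_edge (closed_segment a b)" using \<open>unit_edge e\<close> ab by simp
  obtain i where g: "grid_edge i a b" using unit_edge_imp_grid_edge[OF u] by blast
  obtain n where l: "has_level n i a" using has_level_exists[OF g] by blast
  let ?E = "\<lambda>p t. (+) ((real t * 2 ^ p) *\<^sub>R (b - a)) ` closed_segment a b"
  let ?a = "?v + a" and ?b = "?v + b"
  let ?E' = "\<lambda>p t. (+) ((real t * 2 ^ p) *\<^sub>R (?b - ?a)) ` closed_segment ?a ?b"
  have E': "?E' p t = (+) ?v ` ?E p t" for p t
    unfolding closed_segment_translation image_image by (simp add: algebra_simps)
  have moved: "(?E' p t, d) \<in> folding_pattern S"
    if "(?E p t, d) \<in> folding_pattern S" "t \<le> 2" "p \<le> N" for p t d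
  proof -
    \<comment> \<open>The shift contributes at most \<open>2 * 2 ^ N\<close> and the edge through
      \<open>x\<close> at most 1; the radius leaves the further margin of more than 1 needed to
      exclude cut edges.\<close>
    have sub: "?E p t \<subseteq> cball x (2 * 2 ^ N + 1)"
    proof
      fix z assume "z \<in> ?E p t"
      then obtain z0 where z: "z = (real t * 2 ^ p) *\<^sub>R (b - a) + z0" "z0 \<in> closed_segment a b" by blast
      have "dist x z0 \<le> 1" using unit_edge_diameter[OF u, of x z0] z e ab by blast
      moreover have "dist z0 z = real t * 2 ^ p"
        unfolding z(1) using ab(2) by (simp add: dist_norm norm_minus_commute)
      moreover have "real t * 2 ^ p \<le> 2 * 2 ^ N"
        using that(2,3) by (intro mult_mono power_increasing) auto
      ultimately have "dist x z \<le> 2 * 2 ^ N + 1" using dist_triangle[of x z z0] by linarith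
      then show "z \<in> cball x (2 * 2 ^ N + 1)" by simp
    qed
    show ?thesis
      unfolding E' by (rule restricted_translate_unit_edge[OF tr that(1) sub]) auto
  qed
  have E0: "?E 0 0 = e" "?E' 0 0 = closed_segment ?a ?b" using ab by simp_all
  \<comment> \<open>\<open>q\<close> and \<open>\<delta>\<close> depend only on the position of the
    edge, so one formula serves both \<open>S\<close> and \<open>R\<close>.\<close>
  obtain q \<delta> :: real where col: "\<And>S c t. (?E 0 t, c) \<in> folding_pattern S \<longleftrightarrow>
      c = crease_colour (S (Suc n)) (even \<lceil>q + real t * \<delta>\<rceil>)"
    using line_colours[OF u g l, of 0] by blast
  \<comment> \<open>That the translate is again an edge of the grid is read off from its being
    coloured in the pattern of \<open>S\<close>.\<close>
  have "(?E' 0 0, crease_colour (S (Suc n)) (even \<lceil>q + real 0 * \<delta>\<rceil>)) \<in> folding_pattern S"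
    by (rule moved[OF col[THEN iffD2, OF refl]]) simp_all
  then have u': "unit_edge (closed_segment ?a ?b)"
    unfolding E0 folding_pattern_def finite_folding_pattern_def by blast
  obtain i' where g': "grid_edge i' ?a ?b" using unit_edge_imp_grid_edge[OF u'] by blast
  obtain n' where l': "has_level n' i' ?a" using has_level_exists[OF g'] by blast
  \<comment> \<open>Each edge has exactly one colour, so the implication \<open>moved\<close>
    becomes an equivalence.\<close>
  have same: "(?E p t, d) \<in> folding_pattern S \<longleftrightarrow> (?E' p t, d) \<in> folding_pattern S"
    if "t \<le> 2" "p \<le> N" for p t d
  proof -
    obtain f where f: "\<And>d. (?E p t, d) \<in> folding_pattern S \<longleftrightarrow> d = f"
      using line_colours[OF u g l, of p] by blast
    obtain f' where f': "\<And>d. (?E' p t, d) \<in> folding_pattern S \<longleftrightarrow> d = f'"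
      using line_colours[OF u' g' l', of p] by blast
    have "f = f'" using moved[OF _ that, of f] f f' by blast
    then show ?thesis using f f' by simp
  qed
  obtain q' \<delta>' :: real where col': "\<And>S c t. (?E' 0 t, c) \<in> folding_pattern S \<longleftrightarrow>
      c = crease_colour (S (Suc n')) (even \<lceil>q' + real t * \<delta>'\<rceil>)"
    using line_colours[OF u' g' l', of 0] by blast
  have Scol: "crease_colour (S (Suc n)) (even \<lceil>q\<rceil>) = crease_colour (S (Suc n')) (even \<lceil>q'\<rceil>)"
    using same[of 0 0 "crease_colour (S (Suc n)) (even \<lceil>q\<rceil>)"] unfolding col col' by simp
  have "crease_colour (R (Suc n)) (even \<lceil>q\<rceil>) = crease_colour (R (Suc n')) (even \<lceil>q'\<rceil>)"
  proof (cases "n = n'")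
    case True
    then show ?thesis using Scol crease_colour_inject by simp
  next
    case False
    \<comment> \<open>If the levels differ, the smaller one cannot be at most \<open>N\<close>,
      since the three test edges would then reveal the difference.\<close>
    have "\<not> (n < n' \<and> n \<le> N)"
      using level_distinguished[OF u g l u' g' l', of S] same[where p = n] by blast
    moreover have "\<not> (n' < n \<and> n' \<le> N)"
      using level_distinguished[OF u' g' l' u g l, of S] same[where p = n'] by blast
    ultimately have "N < Suc n" "N < Suc n'" using False by linarith+
    then show ?thesis using Scol tail by simp
  qed
  moreover have "c = crease_colour (R (Suc n)) (even \<lceil>q\<rceil>)"
    using col[of 0 c R] e(1) ab(1) by simp
  ultimately have "(?E' 0 0, c) \<in> folding_pattern R" unfolding col' by simp
  moreover have "?E' 0 0 = (+) ?v ` e" unfolding E' E0 ..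
  ultimately show ?thesis by simp
qed

lemma translate_pattern_compose:
  "translate_pattern u (translate_pattern v A) = translate_pattern (u + v) A"
  unfolding translate_pattern_def image_image
  by (intro image_cong) (auto simp: image_image algebra_simps)

lemma translate_pattern_0: "translate_pattern 0 A = A"
  unfolding translate_pattern_def by (force simp: image_def)

lemma folding_pattern_locally_derivable:
  assumes "finite {i. i \<ge> 1 \<and> S i \<noteq> R i}"
  shows "locally_derivable_from (folding_pattern R) (folding_pattern S)"
proof -
  obtain N where N: "\<forall>i\<in>{i. i \<ge> 1 \<and> S i \<noteq> R i}. i \<le> N"
    using assms finite_nat_set_iff_bounded_le by blast
  have tail: "S i = R i" if "N < i" for i
  proof (rule ccontr)
    assume "S i \<noteq> R i"
    then have "i \<le> N" using N that by auto
    then show False using that by simp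
  qed
  let ?r = "2 * 2 ^ N + 3 :: real"
  \<comment> \<open>One inclusion for all \<open>x\<close>, \<open>y\<close> suffices: the
    hypothesis is symmetric, so exchanging the points and translating back gives the other.\<close>
  have sub: "translate_pattern (y - x) (local_structure (folding_pattern R) x)
      \<subseteq> local_structure (folding_pattern R) y"
    if "translate_pattern (y - x) (restrict_pattern (folding_pattern S) (ball x ?r))
      = restrict_pattern (folding_pattern S) (ball y ?r)" for x y
  proof
    fix z assume "z \<in> translate_pattern (y - x) (local_structure (folding_pattern R) x)"
    then obtain e c where z: "z = ((+) (y - x) ` e, c)" "(e, c) \<in> folding_pattern R" "x \<in> e"
      unfolding translate_pattern_def local_structure_def by auto
    have "y \<in> (+) (y - x) ` e" using z(3) by (intro image_eqI[of _ _ x]) auto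
    then show "z \<in> local_structure (folding_pattern R) y"
      unfolding local_structure_def z(1) using folding_pattern_transfer[OF tail that z(2,3)] by simp
  qed
  have "translate_pattern (y - x) (local_structure (folding_pattern R) x)
      = local_structure (folding_pattern R) y"
    if tr: "translate_pattern (y - x) (restrict_pattern (folding_pattern S) (ball x ?r))
      = restrict_pattern (folding_pattern S) (ball y ?r)" for x y
  proof
    show "translate_pattern (y - x) (local_structure (folding_pattern R) x)
      \<subseteq> local_structure (folding_pattern R) y" by (rule sub[OF tr])
    have "translate_pattern (x - y) (restrict_pattern (folding_pattern S) (ball y ?r))
      = restrict_pattern (folding_pattern S) (ball x ?r)"
      unfolding tr[symmetric] translate_pattern_compose by (simp add: translate_pattern_0)
    then have "translate_pattern (x - y) (local_structure (folding_pattern R) y)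
      \<subseteq> local_structure (folding_pattern R) x" by (rule sub)
    then have "translate_pattern (y - x) (translate_pattern (x - y) (local_structure (folding_pattern R) y))
      \<subseteq> translate_pattern (y - x) (local_structure (folding_pattern R) x)"
      unfolding translate_pattern_def by (rule image_mono)
    then show "local_structure (folding_pattern R) y
      \<subseteq> translate_pattern (y - x) (local_structure (folding_pattern R) x)"
      unfolding translate_pattern_compose by (simp add: translate_pattern_0)
  qed
  moreover have "0 < ?r" by (simp add: add_pos_pos)
  ultimately show ?thesis unfolding locally_derivable_from_def by blast
qed

theorem theorem3p11:
  fixes S R :: "nat \<Rightarrow> folding"
  assumes "finite {i. i \<ge> 1 \<and> S i \<noteq> R i}"
  shows "MLD (folding_pattern S) (folding_pattern R)"
proof -
  have "{i. i \<ge> 1 \<and> R i \<noteq> S i} = {i. i \<ge> 1 \<and> S i \<noteq> R i}" by auto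
  then show ?thesis
    unfolding MLD_def using folding_pattern_locally_derivable assms by metis
qed

end
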